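(* Let $M$ be a semifinite von Neumann algebra with a faithful normal semifinite trace $\tau$. Let $X$ be a Banach space and let $\mathbf{a}_n : X \to S(M)$, $n\in\mathbb{N}$, be a sequence of linear maps satisfying the following two conditions. (i) There are positive constants $C$ and $\alpha$ such that for every nonzero $x\in X$ and every $\varepsilon>0$ there is a projection $p\in P(M)$ with $\tau(p^{\perp})<C(\varepsilon^{-1}\|x\|_X)^{\alpha}$ such that $\|p\,\mathbf{a}_n(x)\,p\|<\varepsilon$ for all $n\in\mathbb{N}$. (ii) There is a dense subset $X_0\subset X$ such that for every $x\in X_0$ one has $\mathbf{a}_m(x)-\mathbf{a}_n(x)\to 0$ b.a.u. as $m,n\to\infty$. Then $\mathbf{a}_m(x)-\mathbf{a}_n(x)\to 0$ b.a.u. as $m,n\to\infty$ for every $x\in X$.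
   Context: $M$ is a semifinite von Neumann algebra acting on a Hilbert space $H$, with unit $\mathbf{1}$, uniform (operator) norm $\|\cdot\|$, and faithful normal semifinite trace $\tau$. $P(M)$ is the lattice of all projections in $M$, and $e^{\perp}=\mathbf{1}-e$ for $e\in P(M)$. A densely defined closed operator $x$ in $H$ is affiliated with $M$ if $y'x\subset xy'$ for every $y'$ in the commutant $M'$. An operator $x$ affiliated with $M$ is $\tau$-measurable if for each $\varepsilon>0$ there is $e\in P(M)$ with $\tau(e^{\perp})\le\varepsilon$ and $eH$ contained in the domain of $x$. $S(M)$ is the $*$-algebra of all $\tau$-measurable operators affiliated with $M$ (with strong sum and product). Bilateral almost uniform (b.a.u.) convergence: $x_n\to x$ b.a.u. in $S(M)$ means that for every $\varepsilon>0$ there is $e\in P(M)$ with $\tau(e^{\perp})\le\varepsilon$ such that $\|e(x_n-x)e\|\to 0$. Likewise, $x_m-x_n\to 0$ b.a.u. as $m,n\to\infty$ means that for every $\varepsilon>0$ there is $e\in P(M)$ with $\tau(e^{\perp})\le\varepsilon$ such that $\|e(x_m-x_n)e\|\to 0$ as $m,n\to\infty$. *)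

theory Defs
  imports "HOL-Analysis.Analysis"
begin

section \<open>Complex Banach and Hilbert spaces\<close>

class complex_normed_vector = real_normed_vector +
  fixes scaleC :: "complex \<Rightarrow> 'a \<Rightarrow> 'a"  (infixr "*\<^sub>C" 75)
  assumes scaleC_add_right: "c *\<^sub>C (x + y) = c *\<^sub>C x + c *\<^sub>C y"
    and scaleC_add_left: "(c + d) *\<^sub>C x = c *\<^sub>C x + d *\<^sub>C x"
    and scaleC_scaleC: "c *\<^sub>C d *\<^sub>C x = (c * d) *\<^sub>C x"
    and scaleR_scaleC: "r *\<^sub>R x = complex_of_real r *\<^sub>C x"
    and norm_scaleC: "norm (c *\<^sub>C x) = cmod c * norm x"

class complex_banach = complex_normed_vector + banach

class complex_hilbert = complex_banach +
  fixes cinner :: "'a \<Rightarrow> 'a \<Rightarrow> complex"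
  assumes cinner_add_left: "cinner (x + y) z = cinner x z + cinner y z"
    and cinner_scaleC_left: "cinner (c *\<^sub>C x) y = c * cinner x y"
    and cinner_commute: "cinner x y = cnj (cinner y x)"
    and cinner_ge_zero: "0 \<le> Re (cinner x x)"
    and norm_eq_sqrt_cinner: "norm x = sqrt (Re (cinner x x))"


section \<open>Von Neumann algebras and traces\<close>

definition bounded_clinear :: "('a::complex_normed_vector \<Rightarrow> 'b::complex_normed_vector) \<Rightarrow> bool" where
  "bounded_clinear T \<longleftrightarrow> bounded_linear T \<and> (\<forall>c x. T (c *\<^sub>C x) = c *\<^sub>C T x)"

definition adjoint_pair :: "('h::complex_hilbert \<Rightarrow> 'h) \<Rightarrow> ('h \<Rightarrow> 'h) \<Rightarrow> bool" where
  "adjoint_pair S T \<longleftrightarrow> (\<forall>x y. cinner (S x) y = cinner x (T y))"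

definition commutant :: "('h::complex_hilbert \<Rightarrow> 'h) set \<Rightarrow> ('h \<Rightarrow> 'h) set" where
  "commutant M = {T. bounded_clinear T \<and> (\<forall>S\<in>M. S \<circ> T = T \<circ> S)}"

text \<open>Being a commutant, such an \<open>M\<close> is a subalgebra of the bounded operators containing the
  identity operator, which is its unit.\<close>

definition von_neumann_algebra :: "('h::complex_hilbert \<Rightarrow> 'h) set \<Rightarrow> bool" where
  "von_neumann_algebra M \<longleftrightarrow>
     (\<forall>T\<in>M. bounded_clinear T) \<and>
     (\<forall>T\<in>M. \<exists>S\<in>M. adjoint_pair T S) \<and>
     commutant (commutant M) = M"

definition positive_op :: "('h::complex_hilbert \<Rightarrow> 'h) \<Rightarrow> bool" where
  "positive_op T \<longleftrightarrow> (\<forall>x. cinner (T x) x \<in> \<real> \<and> 0 \<le> Re (cinner (T x) x))"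

definition op_le :: "('h::complex_hilbert \<Rightarrow> 'h) \<Rightarrow> ('h \<Rightarrow> 'h) \<Rightarrow> bool" where
  "op_le S T \<longleftrightarrow> positive_op (\<lambda>x. T x - S x)"

definition pos_cone :: "('h::complex_hilbert \<Rightarrow> 'h) set \<Rightarrow> ('h \<Rightarrow> 'h) set" where
  "pos_cone M = {T \<in> M. positive_op T}"

text \<open>A trace is a map on the positive cone; the values of \<open>\<tau>\<close> elsewhere are irrelevant.
  In \<^typ>\<open>ennreal\<close> we have \<open>0 * \<infinity> = 0\<close>.\<close>

definition is_trace :: "('h::complex_hilbert \<Rightarrow> 'h) set \<Rightarrow> (('h \<Rightarrow> 'h) \<Rightarrow> ennreal) \<Rightarrow> bool" where
  "is_trace M \<tau> \<longleftrightarrow>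
     (\<forall>S\<in>pos_cone M. \<forall>T\<in>pos_cone M. \<tau> (\<lambda>x. S x + T x) = \<tau> S + \<tau> T) \<and>
     (\<forall>T\<in>pos_cone M. \<forall>c\<ge>0. \<tau> (\<lambda>x. c *\<^sub>R T x) = ennreal c * \<tau> T) \<and>
     (\<forall>S\<in>M. \<forall>T\<in>M. adjoint_pair S T \<longrightarrow> \<tau> (T \<circ> S) = \<tau> (S \<circ> T))"

definition faithful_trace :: "('h::complex_hilbert \<Rightarrow> 'h) set \<Rightarrow> (('h \<Rightarrow> 'h) \<Rightarrow> ennreal) \<Rightarrow> bool" where
  "faithful_trace M \<tau> \<longleftrightarrow> (\<forall>T\<in>pos_cone M. \<tau> T = 0 \<longrightarrow> T = (\<lambda>x. 0))"

text \<open>Increasing nets are represented by their ranges, that is, by upward directed sets.\<close>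

definition normal_trace :: "('h::complex_hilbert \<Rightarrow> 'h) set \<Rightarrow> (('h \<Rightarrow> 'h) \<Rightarrow> ennreal) \<Rightarrow> bool" where
  "normal_trace M \<tau> \<longleftrightarrow>
     (\<forall>D T. D \<noteq> {} \<and> D \<subseteq> pos_cone M \<and>
        (\<forall>R\<in>D. \<forall>S\<in>D. \<exists>U\<in>D. op_le R U \<and> op_le S U) \<and>
        T \<in> pos_cone M \<and> (\<forall>S\<in>D. op_le S T) \<and>
        (\<forall>U\<in>pos_cone M. (\<forall>S\<in>D. op_le S U) \<longrightarrow> op_le T U)
      \<longrightarrow> \<tau> T = (SUP S\<in>D. \<tau> S))"

definition semifinite_trace :: "('h::complex_hilbert \<Rightarrow> 'h) set \<Rightarrow> (('h \<Rightarrow> 'h) \<Rightarrow> ennreal) \<Rightarrow> bool" where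
  "semifinite_trace M \<tau> \<longleftrightarrow>
     (\<forall>T\<in>pos_cone M. T \<noteq> (\<lambda>x. 0) \<longrightarrow>
        (\<exists>S\<in>pos_cone M. S \<noteq> (\<lambda>x. 0) \<and> op_le S T \<and> \<tau> S < \<infinity>))"

definition projections :: "('h::complex_hilbert \<Rightarrow> 'h) set \<Rightarrow> ('h \<Rightarrow> 'h) set" where
  "projections M = {p \<in> M. p \<circ> p = p \<and> adjoint_pair p p}"

definition perp :: "('h::complex_hilbert \<Rightarrow> 'h) \<Rightarrow> 'h \<Rightarrow> 'h" where
  "perp e = (\<lambda>x. x - e x)"


section \<open>Measurable operators\<close>

text \<open>A possibly unbounded, partially defined operator is represented by its graph. Its domain is
  \<^const>\<open>Domain\<close>, it is closed iff its graph is closed, inclusion of operators is inclusion of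
  graphs, and \<open>B O A\<close> is the graph of the product \<open>A B\<close> (first \<open>B\<close>, then \<open>A\<close>).\<close>

type_synonym 'h operator = "('h \<times> 'h) set"

definition op_graph :: "('h \<Rightarrow> 'h) \<Rightarrow> 'h operator" where
  "op_graph T = {(u, T u) |u. True}"

definition linear_operator :: "'h::complex_hilbert operator \<Rightarrow> bool" where
  "linear_operator A \<longleftrightarrow>
     single_valued A \<and> (0, 0) \<in> A \<and>
     (\<forall>u v u' v'. (u, v) \<in> A \<longrightarrow> (u', v') \<in> A \<longrightarrow> (u + u', v + v') \<in> A) \<and>
     (\<forall>c u v. (u, v) \<in> A \<longrightarrow> (c *\<^sub>C u, c *\<^sub>C v) \<in> A)"

definition closed_densely_defined :: "'h::complex_hilbert operator \<Rightarrow> bool" where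
  "closed_densely_defined A \<longleftrightarrow>
     linear_operator A \<and> closed A \<and> closure (Domain A) = UNIV"

definition affiliated :: "('h::complex_hilbert \<Rightarrow> 'h) set \<Rightarrow> 'h operator \<Rightarrow> bool" where
  "affiliated M A \<longleftrightarrow>
     closed_densely_defined A \<and> (\<forall>y\<in>commutant M. A O op_graph y \<subseteq> op_graph y O A)"

definition tau_measurable ::
    "('h::complex_hilbert \<Rightarrow> 'h) set \<Rightarrow> (('h \<Rightarrow> 'h) \<Rightarrow> ennreal) \<Rightarrow> 'h operator \<Rightarrow> bool" where
  "tau_measurable M \<tau> A \<longleftrightarrow>
     affiliated M A \<and>
     (\<forall>\<epsilon>>0. \<exists>e\<in>projections M. \<tau> (perp e) \<le> ennreal \<epsilon> \<and> range e \<subseteq> Domain A)"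

definition measurable_ops ::
    "('h::complex_hilbert \<Rightarrow> 'h) set \<Rightarrow> (('h \<Rightarrow> 'h) \<Rightarrow> ennreal) \<Rightarrow> 'h operator set" where
  "measurable_ops M \<tau> = {A. tau_measurable M \<tau> A}"

text \<open>The algebraic operations of the algebra of measurable operators: closures of the
  operations performed on the natural domains. For scalar multiplication the closure only
  matters for the scalar \<open>0\<close>, where it extends the zero operator to the whole space.\<close>

definition strong_sum :: "'h::complex_hilbert operator \<Rightarrow> 'h operator \<Rightarrow> 'h operator" where
  "strong_sum A B = closure {(u, v + w) |u v w. (u, v) \<in> A \<and> (u, w) \<in> B}"

definition strong_scale :: "complex \<Rightarrow> 'h::complex_hilbert operator \<Rightarrow> 'h operator" where
  "strong_scale c A = closure {(u, c *\<^sub>C v) |u v. (u, v) \<in> A}"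

definition strong_diff :: "'h::complex_hilbert operator \<Rightarrow> 'h operator \<Rightarrow> 'h operator" where
  "strong_diff A B = strong_sum A (strong_scale (-1) B)"

definition strong_product :: "'h::complex_hilbert operator \<Rightarrow> 'h operator \<Rightarrow> 'h operator" where
  "strong_product A B = closure (B O A)"

definition compression :: "('h::complex_hilbert \<Rightarrow> 'h) \<Rightarrow> 'h operator \<Rightarrow> 'h operator" where
  "compression e A = strong_product (op_graph e) (strong_product A (op_graph e))"

text \<open>The value is \<open>\<infinity>\<close> for unbounded operators. A closed densely defined operator of finite norm
  is everywhere defined.\<close>

definition op_norm :: "'h::complex_hilbert operator \<Rightarrow> ennreal" where
  "op_norm A = (SUP (u, v)\<in>{(u, v) \<in> A. norm u \<le> 1}. ennreal (norm v))"

definition linear_into_measurable ::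
    "('h::complex_hilbert \<Rightarrow> 'h) set \<Rightarrow> (('h \<Rightarrow> 'h) \<Rightarrow> ennreal) \<Rightarrow>
     ('x::complex_normed_vector \<Rightarrow> 'h operator) \<Rightarrow> bool" where
  "linear_into_measurable M \<tau> f \<longleftrightarrow>
     (\<forall>x. f x \<in> measurable_ops M \<tau>) \<and>
     (\<forall>x y. f (x + y) = strong_sum (f x) (f y)) \<and>
     (\<forall>c x. f (c *\<^sub>C x) = strong_scale c (f x))"

text \<open>Bilateral almost uniform convergence to \<open>0\<close> of a family along a filter.\<close>

definition bau_null ::
    "('h::complex_hilbert \<Rightarrow> 'h) set \<Rightarrow> (('h \<Rightarrow> 'h) \<Rightarrow> ennreal) \<Rightarrow>
     ('i \<Rightarrow> 'h operator) \<Rightarrow> 'i filter \<Rightarrow> bool" where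
  "bau_null M \<tau> z F \<longleftrightarrow>
     (\<forall>\<epsilon>>0. \<exists>e\<in>projections M. \<tau> (perp e) \<le> ennreal \<epsilon> \<and>
        ((\<lambda>i. op_norm (compression e (z i))) \<longlongrightarrow> 0) F)"

definition bau_cauchy ::
    "('h::complex_hilbert \<Rightarrow> 'h) set \<Rightarrow> (('h \<Rightarrow> 'h) \<Rightarrow> ennreal) \<Rightarrow> (nat \<Rightarrow> 'h operator) \<Rightarrow> bool" where
  "bau_cauchy M \<tau> z \<longleftrightarrow>
     bau_null M \<tau> (\<lambda>(m, n). strong_diff (z m) (z n)) (sequentially \<times>\<^sub>F sequentially)"

end

theory Submission
  imports Defs
begin

text \<open>
  Approximate \<open>x\<close> by some \<open>y\<close> in \<open>X0\<close>. The maximal inequality (i), applied to \<open>x - y\<close>, makes all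
  \<open>a\<^sub>n(x - y)\<close> uniformly small after compression by a projection with small complement, and (ii)
  makes the oscillation of \<open>a\<^sub>n(y)\<close> small after another such compression. On the infimum of
  the two projections the oscillation of \<open>a\<^sub>n(x)\<close> is small (\<open>oscillation_le_of_approximation\<close>).
  Doing this for \<open>\<eta> = 1, 1/2, 1/3, \<dots>\<close>, with complements of summable trace, and passing to the
  infimum of all projections gives the claim. Two facts about the trace and the measurable
  operators carry the argument.

  The first is countable subadditivity, \<open>\<tau>((\<And>\<^sub>n p\<^sub>n)\<^sup>\<bottom>) \<le> \<Sum>\<^sub>n \<tau>(p\<^sub>n\<^sup>\<bottom>)\<close>
  (\<open>countable_inf_projection\<close>). By normality it reduces to two projections and then, by Kaplansky's
  formula, to a comparison of the traces of the left and the right support of a contraction \<open>T\<close> in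
  \<open>M\<close> (\<open>trace_left_support_le\<close>). Instead of the polar decomposition, the proof approximates both
  supports by polynomials in \<open>T T\<^sup>*\<close> and \<open>T\<^sup>* T\<close> whose increments have the form \<open>V V\<^sup>*\<close> and
  \<open>V\<^sup>* V\<close>.

  The second concerns the closures in the definition of the strong operations. All
  domain questions vanish if the projection \<open>e\<close> has its range in the domains of all the countably many
  operators involved: there sums can be formed pointwise. It remains to see that the closed
  relation \<open>strong_diff\<close> contains nothing else over the range of \<open>e\<close>, up to multiplication by \<open>e\<close>
  from the left. This holds if \<open>e A\<close> is bounded for both operators \<open>A\<close>
  in the difference (\<open>strong_diff_left_bounded\<close>), and such \<open>e\<close> with arbitrarily small complement exist
  for every measurable \<open>A\<close> (\<open>measurable_left_bounded\<close>). That lemma is a statement about left supports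
  again, of an unbounded operator; projecting onto its graph turns it into one about a bounded
  operator.
\<close>

section \<open>Geometry of complex Hilbert spaces\<close>

lemma scaleC_zero_left [simp]: "0 *\<^sub>C x = (0::'a::complex_normed_vector)"
  using scaleC_add_left[of 0 0 x] by simp

lemma scaleC_zero_right [simp]: "c *\<^sub>C 0 = (0::'a::complex_normed_vector)"
  using scaleC_add_right[of c 0 0] by simp

lemma scaleC_one [simp]: "1 *\<^sub>C x = (x::'a::complex_normed_vector)"
  using scaleR_scaleC[of 1 x] by simp

lemma scaleC_minus_left: "(- c) *\<^sub>C x = - (c *\<^sub>C (x::'a::complex_normed_vector))"
  using scaleC_add_left[of c "- c" x] by (simp add: eq_neg_iff_add_eq_0 add.commute)

lemma scaleC_minus_right: "c *\<^sub>C (- x) = - (c *\<^sub>C (x::'a::complex_normed_vector))"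
  using scaleC_add_right[of c x "- x"] by (simp add: eq_neg_iff_add_eq_0 add.commute)

lemma scaleC_diff_right: "c *\<^sub>C (x - y) = c *\<^sub>C x - c *\<^sub>C (y::'a::complex_normed_vector)"
  using scaleC_add_right[of c x "- y"] by (simp add: scaleC_minus_right)

lemma cinner_add_right: "cinner x (y + z) = cinner x y + cinner x (z::'a::complex_hilbert)"
  by (metis cinner_add_left cinner_commute complex_cnj_add)

lemma cinner_scaleC_right: "cinner x (c *\<^sub>C y) = cnj c * cinner x (y::'a::complex_hilbert)"
  by (metis cinner_scaleC_left cinner_commute complex_cnj_mult)

lemma cinner_scaleR_left: "cinner (r *\<^sub>R x) y = r *\<^sub>R cinner x (y::'a::complex_hilbert)"
  by (simp add: scaleR_scaleC cinner_scaleC_left scaleR_conv_of_real)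

lemma cinner_scaleR_right: "cinner x (r *\<^sub>R y) = r *\<^sub>R cinner x (y::'a::complex_hilbert)"
  by (simp add: scaleR_scaleC cinner_scaleC_right scaleR_conv_of_real)

lemma cinner_zero_left [simp]: "cinner 0 (y::'a::complex_hilbert) = 0"
  using cinner_scaleC_left[of 0 0 y] by simp

lemma cinner_zero_right [simp]: "cinner (y::'a::complex_hilbert) 0 = 0"
  using cinner_scaleC_right[of y 0 0] by simp

lemma cinner_minus_left: "cinner (- x) y = - cinner x (y::'a::complex_hilbert)"
  using cinner_scaleR_left[of "- 1" x y] by simp

lemma cinner_minus_right: "cinner x (- y) = - cinner x (y::'a::complex_hilbert)"
  using cinner_scaleR_right[of x "- 1" y] by simp

lemma cinner_diff_left: "cinner (x - y) z = cinner x z - cinner y (z::'a::complex_hilbert)"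
  using cinner_add_left[of x "- y" z] by (simp add: cinner_minus_left)

lemma cinner_diff_right: "cinner z (x - y) = cinner z x - cinner z (y::'a::complex_hilbert)"
  using cinner_add_right[of z x "- y"] by (simp add: cinner_minus_right)

lemmas cinner_linear =
  cinner_add_left cinner_add_right cinner_diff_left cinner_diff_right
  cinner_minus_left cinner_minus_right

lemma power2_norm_eq_cinner: "(norm x)\<^sup>2 = Re (cinner x (x::'a::complex_hilbert))"
  by (simp add: norm_eq_sqrt_cinner cinner_ge_zero)

lemma cinner_self: "cinner x x = complex_of_real ((norm (x::'a::complex_hilbert))\<^sup>2)"
proof (rule complex_eqI)
  show "Im (cinner x x) = Im (complex_of_real ((norm x)\<^sup>2))"
    using arg_cong[OF cinner_commute[of x x], of Im] by simp
qed (simp add: power2_norm_eq_cinner)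

lemma cinner_self_eq_0 [simp]: "cinner x x = 0 \<longleftrightarrow> (x::'a::complex_hilbert) = 0"
  by (simp add: cinner_self)

lemma eq_iff_cinner_left: "x = y \<longleftrightarrow> (\<forall>z. cinner z x = cinner z (y::'a::complex_hilbert))"
proof
  assume "\<forall>z. cinner z x = cinner z y"
  then have "cinner (x - y) (x - y) = 0" by (simp only: cinner_diff_right) simp
  then show "x = y" by simp
qed simp

text \<open>The squared distance of \<open>x\<close> from the line through \<open>y\<close>. It yields the Cauchy-Schwarz inequality
  by nonnegativity, and the orthogonality of a closest point by minimality.\<close>

lemma norm_diff_component:
  fixes x y :: "'a::complex_hilbert"
  assumes "y \<noteq> 0"
  shows "(norm (x - (cinner x y / of_real ((norm y)\<^sup>2)) *\<^sub>C y))\<^sup>2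
    = (norm x)\<^sup>2 - (cmod (cinner x y))\<^sup>2 / (norm y)\<^sup>2"
proof -
  define n where "n = complex_of_real ((norm y)\<^sup>2)"
  have n: "n \<noteq> 0" "cnj n = n" "cinner y y = n" using assms by (auto simp: n_def cinner_self)
  let ?c = "cinner x y / n"
  have "cinner (x - ?c *\<^sub>C y) (x - ?c *\<^sub>C y)
      = cinner x x - cnj ?c * cinner x y - ?c * (cinner y x - cnj ?c * n)"
    by (simp add: cinner_linear cinner_scaleC_left cinner_scaleC_right n(3) algebra_simps)
  also have "\<dots> = cinner x x - cinner x y * cnj (cinner x y) / n"
    using n by (simp add: cinner_commute[of y x] field_simps)
  also have "\<dots> = complex_of_real ((norm x)\<^sup>2 - (cmod (cinner x y))\<^sup>2 / (norm y)\<^sup>2)"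
    by (simp add: cinner_self n_def complex_norm_square del: of_real_power)
  finally show ?thesis
    unfolding power2_norm_eq_cinner[of "x - _"] n_def by simp
qed

lemma Cauchy_Schwarz_cinner: "cmod (cinner x y) \<le> norm x * norm (y::'a::complex_hilbert)"
proof (cases "y = 0")
  case False
  have "0 \<le> (norm x)\<^sup>2 - (cmod (cinner x y))\<^sup>2 / (norm y)\<^sup>2"
    unfolding norm_diff_component[OF False, symmetric] by simp
  then have "(cmod (cinner x y))\<^sup>2 \<le> (norm x * norm y)\<^sup>2"
    using False by (simp add: field_simps power_mult_distrib)
  then show ?thesis by (rule power2_le_imp_le) simp
qed simp

lemma bounded_linear_cinner_left: "bounded_linear (\<lambda>x. cinner x (y::'a::complex_hilbert))"
  by (rule bounded_linear_intro[where K = "norm y"])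
    (simp_all add: cinner_add_left cinner_scaleR_left Cauchy_Schwarz_cinner)

lemma bounded_linear_cinner_right: "bounded_linear (\<lambda>y. cinner (x::'a::complex_hilbert) y)"
  by (rule bounded_linear_intro[where K = "norm x"])
    (simp_all add: cinner_add_right cinner_scaleR_right Cauchy_Schwarz_cinner mult.commute[of _ "norm x"])

lemma Pythagoras_cinner:
  fixes x y :: "'a::complex_hilbert"
  assumes "cinner x y = 0"
  shows "(norm (x + y))\<^sup>2 = (norm x)\<^sup>2 + (norm y)\<^sup>2"
  using assms cinner_commute[of y x] by (simp add: power2_norm_eq_cinner cinner_linear)

lemma parallelogram_cinner:
  fixes x y :: "'a::complex_hilbert"
  shows "(norm (x + y))\<^sup>2 + (norm (x - y))\<^sup>2 = 2 * (norm x)\<^sup>2 + 2 * (norm y)\<^sup>2"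
  by (simp add: power2_norm_eq_cinner cinner_linear)

text \<open>The direct sum carries the graphs of operators, so that these become subspaces of a
  Hilbert space.\<close>

instantiation prod :: (complex_hilbert, complex_hilbert) complex_hilbert
begin

definition scaleC_prod :: "complex \<Rightarrow> 'a \<times> 'b \<Rightarrow> 'a \<times> 'b" where
  "scaleC_prod c z = (c *\<^sub>C fst z, c *\<^sub>C snd z)"

definition cinner_prod :: "'a \<times> 'b \<Rightarrow> 'a \<times> 'b \<Rightarrow> complex" where
  "cinner_prod w z = cinner (fst w) (fst z) + cinner (snd w) (snd z)"

instance
proof
  fix c d :: complex and r :: real and x y z :: "'a \<times> 'b"
  show "c *\<^sub>C (x + y) = c *\<^sub>C x + c *\<^sub>C y" by (simp add: scaleC_prod_def scaleC_add_right)
  show "(c + d) *\<^sub>C x = c *\<^sub>C x + d *\<^sub>C x" by (simp add: scaleC_prod_def scaleC_add_left)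
  show "c *\<^sub>C d *\<^sub>C x = (c * d) *\<^sub>C x" by (simp add: scaleC_prod_def scaleC_scaleC)
  show "r *\<^sub>R x = complex_of_real r *\<^sub>C x"
    by (simp add: scaleC_prod_def scaleR_prod_def scaleR_scaleC)
  show "norm (c *\<^sub>C x) = cmod c * norm x"
    by (simp add: scaleC_prod_def norm_prod_def norm_scaleC power_mult_distrib real_sqrt_mult
        flip: distrib_left)
  show "cinner (x + y) z = cinner x z + cinner y z"
    by (simp add: cinner_prod_def cinner_add_left)
  show "cinner (c *\<^sub>C x) y = c * cinner x y"
    by (simp add: cinner_prod_def scaleC_prod_def cinner_scaleC_left distrib_left)
  show "cinner x y = cnj (cinner y x)"
    by (simp add: cinner_prod_def flip: cinner_commute)
  show "0 \<le> Re (cinner x x)" by (simp add: cinner_prod_def cinner_ge_zero)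
  show "norm x = sqrt (Re (cinner x x))"
    by (simp add: cinner_prod_def norm_prod_def norm_eq_sqrt_cinner cinner_ge_zero)
qed

end

definition csubspace :: "'a::complex_normed_vector set \<Rightarrow> bool" where
  "csubspace K \<longleftrightarrow> 0 \<in> K \<and> (\<forall>x\<in>K. \<forall>y\<in>K. x + y \<in> K) \<and> (\<forall>c. \<forall>x\<in>K. c *\<^sub>C x \<in> K)"

lemma csubspace_diff: "csubspace K \<Longrightarrow> x \<in> K \<Longrightarrow> y \<in> K \<Longrightarrow> x - y \<in> K"
  unfolding csubspace_def using scaleC_minus_left[of 1 y]
  by (metis scaleC_one diff_conv_add_uminus)

lemma csubspace_scaleR: "csubspace K \<Longrightarrow> x \<in> K \<Longrightarrow> r *\<^sub>R x \<in> K"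
  by (simp add: csubspace_def scaleR_scaleC)

text \<open>A minimizing sequence for the distance from \<open>x\<close> to \<open>K\<close> is Cauchy by the parallelogram law, since
  midpoints stay in \<open>K\<close>.\<close>

lemma orthogonal_projection_exists:
  fixes K :: "'a::complex_hilbert set"
  assumes K: "csubspace K" "closed K"
  shows "\<exists>k\<in>K. \<forall>m\<in>K. cinner (x - k) m = 0"
proof -
  define d where "d = (INF m\<in>K. (norm (x - m))\<^sup>2)"
  have bdd: "bdd_below ((\<lambda>m. (norm (x - m))\<^sup>2) ` K)" by (rule bdd_belowI[of _ 0]) auto
  have d_le: "d \<le> (norm (x - m))\<^sup>2" if "m \<in> K" for m
    unfolding d_def by (rule cINF_lower[OF bdd that])
  have K0: "K \<noteq> {}" using K by (auto simp: csubspace_def)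
  have "\<exists>m\<in>K. (norm (x - m))\<^sup>2 < d + inverse (real (Suc n))" for n
    using cINF_less_iff[OF K0 bdd, of "d + inverse (real (Suc n))"] by (simp add: d_def)
  then obtain f where f: "\<And>n. f n \<in> K" "\<And>n. (norm (x - f n))\<^sup>2 < d + inverse (real (Suc n))"
    by metis
  have close: "(norm (f i - f j))\<^sup>2 \<le> 2 * inverse (real (Suc i)) + 2 * inverse (real (Suc j))" for i j
  proof -
    have "(1/2) *\<^sub>R (f i + f j) \<in> K"
      using K f by (intro csubspace_scaleR) (auto simp: csubspace_def)
    from d_le[OF this] have "d \<le> (norm ((1/2) *\<^sub>R ((x - f i) + (x - f j))))\<^sup>2"
      by (simp add: algebra_simps flip: scaleR_add_left)
    then have "4 * d \<le> (norm ((x - f i) + (x - f j)))\<^sup>2"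
      by (simp add: power_mult_distrib power2_eq_square)
    moreover have "(norm ((x - f i) + (x - f j)))\<^sup>2 + (norm (f j - f i))\<^sup>2
        = 2 * (norm (x - f i))\<^sup>2 + 2 * (norm (x - f j))\<^sup>2"
      using parallelogram_cinner[of "x - f i" "x - f j"] by simp
    ultimately show ?thesis using f(2)[of i] f(2)[of j] by (simp add: norm_minus_commute)
  qed
  have "Cauchy f"
  proof (rule metric_CauchyI)
    fix e :: real assume e: "e > 0"
    obtain N where N: "inverse (real (Suc N)) < e\<^sup>2 / 4"
      using reals_Archimedean[of "e\<^sup>2 / 4"] e by auto
    have "dist (f i) (f j) < e" if "i \<ge> N" "j \<ge> N" for i j
    proof (rule power2_less_imp_less)
      have "inverse (real (Suc i)) \<le> inverse (real (Suc N))" "inverse (real (Suc j)) \<le> inverse (real (Suc N))"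
        using that by (auto intro!: le_imp_inverse_le)
      then show "(dist (f i) (f j))\<^sup>2 < e\<^sup>2"
        using close[of i j] N unfolding dist_norm by linarith
    qed (use e in simp)
    then show "\<exists>N. \<forall>i\<ge>N. \<forall>j\<ge>N. dist (f i) (f j) < e" by blast
  qed
  then obtain k where k: "f \<longlonglongrightarrow> k" using Cauchy_convergent_iff convergent_def by blast
  have kK: "k \<in> K" using closed_sequentially[OF K(2) _ k] f by blast
  have "(\<lambda>n. (norm (x - f n))\<^sup>2) \<longlonglongrightarrow> (norm (x - k))\<^sup>2"
    by (intro tendsto_intros k)
  moreover have "(\<lambda>n. d + inverse (real (Suc n))) \<longlonglongrightarrow> d + 0"
    by (intro tendsto_intros LIMSEQ_inverse_real_of_nat)
  ultimately have min: "(norm (x - k))\<^sup>2 \<le> d"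
    using f(2) by (intro LIMSEQ_le[of _ _ _ d]) (auto intro: less_imp_le)
  have "cinner (x - k) m = 0" if m: "m \<in> K" for m
  proof (cases "m = 0")
    case False
    define c where "c = cinner (x - k) m / of_real ((norm m)\<^sup>2)"
    have "k + c *\<^sub>C m \<in> K" using K kK m by (auto simp: csubspace_def)
    from d_le[OF this] have "d \<le> (norm ((x - k) - c *\<^sub>C m))\<^sup>2" by (simp add: algebra_simps)
    then have "d \<le> (norm (x - k))\<^sup>2 - (cmod (cinner (x - k) m))\<^sup>2 / (norm m)\<^sup>2"
      using norm_diff_component[OF False, of "x - k"] by (simp add: c_def)
    with min have "(cmod (cinner (x - k) m))\<^sup>2 / (norm m)\<^sup>2 \<le> 0" by simp
    then show ?thesis using False by (simp add: divide_le_0_iff)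
  qed simp
  with kK show ?thesis by blast
qed

definition cproj :: "'a::complex_hilbert set \<Rightarrow> 'a \<Rightarrow> 'a" where
  "cproj K x = (SOME k. k \<in> K \<and> (\<forall>m\<in>K. cinner (x - k) m = 0))"

context
  fixes K :: "'a::complex_hilbert set"
  assumes K: "csubspace K" "closed K"
begin

lemma cproj_mem: "cproj K x \<in> K"
  and cproj_orthogonal: "m \<in> K \<Longrightarrow> cinner (x - cproj K x) m = 0"
  using someI_ex[of "\<lambda>k. k \<in> K \<and> (\<forall>m\<in>K. cinner (x - k) m = 0)"]
    orthogonal_projection_exists[OF K, of x] unfolding cproj_def by blast+

lemma cproj_unique:
  assumes "k \<in> K" "\<And>m. m \<in> K \<Longrightarrow> cinner (x - k) m = 0"
  shows "cproj K x = k"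
proof -
  have *: "cproj K x - k \<in> K" by (intro csubspace_diff K cproj_mem assms(1))
  have "cinner (cproj K x - k) (cproj K x - k)
      = cinner (x - k) (cproj K x - k) - cinner (x - cproj K x) (cproj K x - k)"
    by (simp add: cinner_linear)
  also have "\<dots> = 0" using assms(2)[OF *] cproj_orthogonal[OF *] by simp
  finally show ?thesis by simp
qed

lemma cproj_fixes: "x \<in> K \<Longrightarrow> cproj K x = x"
  by (rule cproj_unique) auto

lemma cproj_eq_0_iff: "cproj K x = 0 \<longleftrightarrow> (\<forall>m\<in>K. cinner x m = 0)"
proof
  show "\<forall>m\<in>K. cinner x m = 0" if "cproj K x = 0" using cproj_orthogonal[of _ x] that by simp
  show "cproj K x = 0" if "\<forall>m\<in>K. cinner x m = 0"
    using that K by (intro cproj_unique) (auto simp: csubspace_def)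
qed

lemma range_cproj: "range (cproj K) = K"
  using cproj_mem cproj_fixes by (metis image_subset_iff rangeI subsetI subset_antisym)

lemma adjoint_pair_cproj: "adjoint_pair (cproj K) (cproj K)"
  unfolding adjoint_pair_def
proof (intro allI)
  fix x y
  have "cinner (cproj K x) (y - cproj K y) = 0"
    using cproj_orthogonal[OF cproj_mem, of y x] by (metis cinner_commute complex_cnj_zero)
  then show "cinner (cproj K x) y = cinner x (cproj K y)"
    using cproj_orthogonal[OF cproj_mem, of x y] by (simp add: cinner_linear)
qed

lemma norm_cproj_le: "norm (cproj K x) \<le> norm x"
proof (rule power2_le_imp_le)
  show "(norm (cproj K x))\<^sup>2 \<le> (norm x)\<^sup>2"
    using Pythagoras_cinner[OF cproj_orthogonal[OF cproj_mem], of x x] by simp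
qed simp

lemma bounded_clinear_cproj: "bounded_clinear (cproj K)"
proof -
  have add: "cproj K (x + y) = cproj K x + cproj K y" for x y
  proof (rule cproj_unique)
    show "cproj K x + cproj K y \<in> K" using K cproj_mem by (simp add: csubspace_def)
    show "cinner (x + y - (cproj K x + cproj K y)) m = 0" if "m \<in> K" for m
      using cproj_orthogonal[OF that, of x] cproj_orthogonal[OF that, of y] by (simp add: cinner_linear)
  qed
  have scale: "cproj K (c *\<^sub>C x) = c *\<^sub>C cproj K x" for c x
  proof (rule cproj_unique)
    show "c *\<^sub>C cproj K x \<in> K" using K cproj_mem by (simp add: csubspace_def)
    show "cinner (c *\<^sub>C x - c *\<^sub>C cproj K x) m = 0" if "m \<in> K" for m
      using cproj_orthogonal[OF that, of x]
      by (simp add: cinner_scaleC_left flip: scaleC_diff_right)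
  qed
  have "bounded_linear (cproj K)"
    by (rule bounded_linear_intro[where K = 1]) (simp_all add: add scale scaleR_scaleC norm_cproj_le)
  then show ?thesis by (simp add: bounded_clinear_def scale)
qed

end

lemma bounded_clinear_add: "bounded_clinear T \<Longrightarrow> T (x + y) = T x + T y"
  by (simp add: bounded_clinear_def linear_simps(1))

lemma bounded_clinear_diff: "bounded_clinear T \<Longrightarrow> T (x - y) = T x - T y"
  by (simp add: bounded_clinear_def linear_simps(2))

lemma bounded_clinear_minus: "bounded_clinear T \<Longrightarrow> T (- x) = - T x"
  by (simp add: bounded_clinear_def linear_simps(4))

lemma bounded_clinear_zero: "bounded_clinear T \<Longrightarrow> T 0 = 0"
  by (simp add: bounded_clinear_def linear_simps(3))

lemma bounded_clinear_scaleC: "bounded_clinear T \<Longrightarrow> T (c *\<^sub>C x) = c *\<^sub>C T x"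
  by (simp add: bounded_clinear_def)

lemma bounded_clinear_tendsto: "bounded_clinear T \<Longrightarrow> (f \<longlongrightarrow> l) F \<Longrightarrow> ((\<lambda>i. T (f i)) \<longlongrightarrow> T l) F"
  by (auto simp: bounded_clinear_def intro: bounded_linear.tendsto)

lemma bounded_clinear_continuous_on: "bounded_clinear T \<Longrightarrow> continuous_on S T"
  by (auto simp: bounded_clinear_def intro: linear_continuous_on)

lemma bounded_clinear_closed_kernel:
  assumes "bounded_clinear T" shows "closed {x. T x = 0}" "csubspace {x. T x = 0}"
proof -
  show "closed {x. T x = 0}"
    by (intro closed_Collect_eq bounded_clinear_continuous_on assms continuous_on_const)
  show "csubspace {x. T x = 0}"
    by (simp add: csubspace_def assms bounded_clinear_zero bounded_clinear_add bounded_clinear_scaleC)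
qed

lemma Riesz_representation:
  fixes f :: "'a::complex_hilbert \<Rightarrow> complex"
  assumes lin: "bounded_linear f" and C: "\<And>c x. f (c *\<^sub>C x) = c * f x"
  shows "\<exists>s. \<forall>u. f u = cinner u s"
proof (cases "\<forall>u. f u = 0")
  case True
  then show ?thesis by (intro exI[of _ 0]) simp
next
  case False
  then obtain x where x: "f x \<noteq> 0" by blast
  let ?K = "{u. f u = 0}"
  have K: "csubspace ?K" "closed ?K"
    using lin by (auto simp: csubspace_def C linear_simps[OF lin]
        intro!: closed_Collect_eq linear_continuous_on continuous_on_const)
  \<comment> \<open>The orthogonal complement of the kernel is the line through \<open>z\<close>.\<close>
  define z where "z = x - cproj ?K x"
  have fz: "f z = f x" using cproj_mem[OF K, of x] by (simp add: z_def linear_simps[OF lin])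
  have z0: "z \<noteq> 0" using fz x linear_simps(3)[OF lin] by auto
  define s where "s = cnj (f z / of_real ((norm z)\<^sup>2)) *\<^sub>C z"
  have "f u = cinner u s" for u
  proof -
    have "f (u - (f u / f z) *\<^sub>C z) = 0" using fz x by (simp add: linear_simps[OF lin] C)
    then have "cinner z (u - (f u / f z) *\<^sub>C z) = 0"
      using cproj_orthogonal[OF K, of _ x] by (simp add: z_def)
    then have "cinner (u - (f u / f z) *\<^sub>C z) z = 0"
      by (metis cinner_commute complex_cnj_zero)
    then have "cinner u z = f u / f z * of_real ((norm z)\<^sup>2)"
      by (simp add: cinner_linear cinner_scaleC_left cinner_self)
    then show ?thesis using z0 fz x by (simp add: s_def cinner_scaleC_right)
  qed
  then show ?thesis by blast
qed

lemma adjoint_pair_sym: "adjoint_pair S T \<Longrightarrow> adjoint_pair T S"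
  unfolding adjoint_pair_def by (metis cinner_commute)

lemma adjoint_exists:
  fixes y :: "'a::complex_hilbert \<Rightarrow> 'a"
  assumes y: "bounded_clinear y"
  shows "\<exists>s. bounded_clinear s \<and> adjoint_pair y s"
proof -
  have "\<exists>s. \<forall>u. cinner (y u) w = cinner u s" for w
  proof (rule Riesz_representation)
    show "bounded_linear (\<lambda>u. cinner (y u) w)"
      using bounded_linear_compose[OF bounded_linear_cinner_left] y
      unfolding bounded_clinear_def by blast
    show "cinner (y (c *\<^sub>C u)) w = c * cinner (y u) w" for c u
      by (simp add: bounded_clinear_scaleC[OF y] cinner_scaleC_left)
  qed
  then obtain s where s: "\<And>w u. cinner (y u) w = cinner u (s w)" by metis
  have "s (v + w) = s v + s w" for v w
    by (subst eq_iff_cinner_left) (simp add: cinner_add_right flip: s)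
  moreover have scale: "s (c *\<^sub>C v) = c *\<^sub>C s v" for c v
    by (subst eq_iff_cinner_left) (simp add: cinner_scaleC_right flip: s)
  moreover
  obtain B where B: "\<And>u. norm (y u) \<le> norm u * B"
    using y bounded_linear.bounded unfolding bounded_clinear_def by blast
  have "norm (s w) \<le> norm w * B" for w
  proof (cases "s w = 0")
    case True
    have "0 \<le> norm w * B" using B[of w] norm_ge_zero order_trans by blast
    with True show ?thesis by simp
  next
    case False
    have "(norm (s w))\<^sup>2 = Re (cinner (y (s w)) w)" by (simp add: s power2_norm_eq_cinner)
    also have "\<dots> \<le> norm (y (s w)) * norm w"
      using Cauchy_Schwarz_cinner complex_Re_le_cmod order_trans by blast
    also have "\<dots> \<le> norm (s w) * B * norm w" by (intro mult_right_mono B) simp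
    finally show ?thesis using False by (simp add: power2_eq_square mult.assoc mult.commute[of B])
  qed
  ultimately have "bounded_linear s"
    by (intro bounded_linear_intro[where K = B]) (auto simp: scaleR_scaleC)
  then show ?thesis using scale s by (auto simp: bounded_clinear_def adjoint_pair_def)
qed

text \<open>Invariance of \<open>K\<close> under the adjoint makes \<open>y\<close> preserve the orthogonal complement of \<open>K\<close>.\<close>

lemma cproj_commutes:
  assumes K: "csubspace K" "closed K" and y: "bounded_clinear y" and ys: "adjoint_pair y s"
    and inv: "\<And>k. k \<in> K \<Longrightarrow> y k \<in> K" "\<And>k. k \<in> K \<Longrightarrow> s k \<in> K"
  shows "cproj K (y u) = y (cproj K u)"
proof (rule cproj_unique[OF K])
  show "y (cproj K u) \<in> K" by (intro inv cproj_mem K)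
  show "cinner (y u - y (cproj K u)) m = 0" if "m \<in> K" for m
    using cproj_orthogonal[OF K inv(2)[OF that], of u] ys
    by (simp add: adjoint_pair_def flip: bounded_clinear_diff[OF y])
qed


lemma bounded_clinear_scale: "bounded_clinear (\<lambda>x. c *\<^sub>C x)"
  unfolding bounded_clinear_def
  by (auto intro!: bounded_linear_intro[where K = "cmod c"]
      simp: scaleC_add_right norm_scaleC scaleR_scaleC scaleC_scaleC mult.commute)

lemma csubspace_closure:
  assumes K: "csubspace K" shows "csubspace (closure K)"
  unfolding csubspace_def
proof (intro conjI ballI allI)
  show "0 \<in> closure K" using K closure_subset by (auto simp: csubspace_def)
  fix x assume "x \<in> closure K"
  then obtain a where a: "\<forall>n. a n \<in> K" "a \<longlonglongrightarrow> x" using closure_sequential[of x K] by blast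
  show "x + y \<in> closure K" if "y \<in> closure K" for y
  proof -
    obtain b where b: "\<forall>n. b n \<in> K" "b \<longlonglongrightarrow> y" using \<open>y \<in> closure K\<close> closure_sequential[of y K] by blast
    have "\<forall>n. a n + b n \<in> K" using a(1) b(1) K by (simp add: csubspace_def)
    then show ?thesis using tendsto_add[OF a(2) b(2)] unfolding closure_sequential[of "x + y" K]
      by (intro exI[of _ "\<lambda>n. a n + b n"]) simp
  qed
  show "c *\<^sub>C x \<in> closure K" for c
  proof -
    have "\<forall>n. c *\<^sub>C a n \<in> K" using a(1) K by (simp add: csubspace_def)
    then show ?thesis
      using bounded_clinear_tendsto[OF bounded_clinear_scale[of c] a(2)]
      unfolding closure_sequential[of "c *\<^sub>C x" K] by (intro exI[of _ "\<lambda>n. c *\<^sub>C a n"]) simp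
  qed
qed

lemma csubspace_range:
  assumes T: "bounded_clinear T" shows "csubspace (range T)"
  unfolding csubspace_def
proof (intro conjI ballI allI)
  show "0 \<in> range T" by (rule range_eqI[of _ _ 0]) (simp add: bounded_clinear_zero[OF T])
  fix x assume "x \<in> range T"
  then obtain u where u: "x = T u" by blast
  show "c *\<^sub>C x \<in> range T" for c
    by (rule range_eqI[of _ _ "c *\<^sub>C u"]) (simp add: u bounded_clinear_scaleC[OF T])
  show "x + y \<in> range T" if "y \<in> range T" for y
  proof -
    from that obtain v where "y = T v" ..
    then show ?thesis by (intro range_eqI[of _ _ "u + v"]) (simp add: u bounded_clinear_add[OF T])
  qed
qed

lemma csubspace_Int: "csubspace K \<Longrightarrow> csubspace L \<Longrightarrow> csubspace (K \<inter> L)"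
  by (simp add: csubspace_def)

lemma csubspace_INT: "(\<And>i. i \<in> I \<Longrightarrow> csubspace (K i)) \<Longrightarrow> csubspace (\<Inter>i\<in>I. K i)"
  by (simp add: csubspace_def)

lemma bounded_clinear_comp: "bounded_clinear S \<Longrightarrow> bounded_clinear T \<Longrightarrow> bounded_clinear (S \<circ> T)"
  unfolding bounded_clinear_def o_def by (auto intro: bounded_linear_compose)

lemma bounded_clinear_sub:
  "bounded_clinear S \<Longrightarrow> bounded_clinear T \<Longrightarrow> bounded_clinear (\<lambda>x. S x - T x)"
  unfolding bounded_clinear_def by (auto intro: bounded_linear_sub simp: scaleC_diff_right)

lemma bounded_clinear_id: "bounded_clinear (\<lambda>x. x)"
  by (simp add: bounded_clinear_def bounded_linear_ident)

lemma selfadjoint_cinner_real: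
  assumes "adjoint_pair T T" shows "cinner (T x) x = complex_of_real (Re (cinner (T x) x))"
proof -
  have "cinner (T x) x = cnj (cinner (T x) x)"
    using assms by (metis adjoint_pair_def cinner_commute)
  then show ?thesis by (metis Reals_cnj_iff of_real_Re)
qed

lemma positive_op_selfadjoint:
  "adjoint_pair T T \<Longrightarrow> (\<And>x. 0 \<le> Re (cinner (T x) x)) \<Longrightarrow> positive_op T"
  unfolding positive_op_def by (metis selfadjoint_cinner_real Reals_of_real)

section \<open>Projections of a von Neumann algebra\<close>

locale vN_algebra =
  fixes M :: "('h::complex_hilbert \<Rightarrow> 'h) set"
  assumes vN: "von_neumann_algebra M"
begin

lemma M_bounded: "T \<in> M \<Longrightarrow> bounded_clinear T"
  using vN by (auto simp: von_neumann_algebra_def)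

lemma M_adjoint: "T \<in> M \<Longrightarrow> \<exists>S\<in>M. adjoint_pair T S"
  using vN by (auto simp: von_neumann_algebra_def)

lemma M_intro:
  assumes "bounded_clinear T" "\<And>y u. y \<in> commutant M \<Longrightarrow> y (T u) = T (y u)"
  shows "T \<in> M"
proof -
  have "T \<in> commutant (commutant M)" using assms by (auto simp: commutant_def[of "commutant M"])
  then show ?thesis using vN by (auto simp: von_neumann_algebra_def)
qed

lemma commutant_commutes: "y \<in> commutant M \<Longrightarrow> T \<in> M \<Longrightarrow> y (T u) = T (y u)"
  by (auto simp: commutant_def fun_eq_iff)

lemma commutant_bounded: "y \<in> commutant M \<Longrightarrow> bounded_clinear y"
  by (simp add: commutant_def)

text \<open>The commutant is closed under adjoints because \<open>M\<close> is.\<close>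

lemma commutant_adjoint:
  assumes y: "y \<in> commutant M" shows "\<exists>s\<in>commutant M. adjoint_pair y s"
proof -
  obtain s where s: "bounded_clinear s" "adjoint_pair y s"
    using adjoint_exists[OF commutant_bounded[OF y]] by blast
  have "T (s u) = s (T u)" if T: "T \<in> M" for T u
  proof -
    obtain R where R: "R \<in> M" "adjoint_pair R T"
      using M_adjoint[OF T] adjoint_pair_sym by blast
    have "cinner z (T (s u)) = cinner z (s (T u))" for z
      using R s(2) commutant_commutes[OF y R(1)] by (metis adjoint_pair_def)
    then show ?thesis by (simp add: eq_iff_cinner_left)
  qed
  then show ?thesis using s by (auto simp: commutant_def fun_eq_iff)
qed

lemma M_comp: "S \<in> M \<Longrightarrow> T \<in> M \<Longrightarrow> S \<circ> T \<in> M"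
  by (rule M_intro) (simp_all add: bounded_clinear_comp M_bounded commutant_commutes[of _ S] commutant_commutes[of _ T])

lemma M_sub: "S \<in> M \<Longrightarrow> T \<in> M \<Longrightarrow> (\<lambda>x. S x - T x) \<in> M"
  by (rule M_intro) (simp_all add: bounded_clinear_sub M_bounded commutant_commutes[of _ S]
      commutant_commutes[of _ T] bounded_clinear_diff[OF commutant_bounded])

lemma M_id: "(\<lambda>x. x) \<in> M"
  by (rule M_intro) (auto intro: bounded_clinear_id)

lemma M_perp: "T \<in> M \<Longrightarrow> perp T \<in> M"
  unfolding perp_def by (rule M_sub[OF M_id])

text \<open>The source of all projections of \<open>M\<close> below: as the commutant contains adjoints, invariance of
  \<open>K\<close> passes to its orthogonal complement, so the projection commutes with the commutant and lies in
  \<open>M\<close> by the double commutant property.\<close>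

lemma cproj_in_projections:
  assumes K: "csubspace K" "closed K" and inv: "\<And>y k. y \<in> commutant M \<Longrightarrow> k \<in> K \<Longrightarrow> y k \<in> K"
  shows "cproj K \<in> projections M"
proof -
  have "cproj K \<in> M"
  proof (rule M_intro[OF bounded_clinear_cproj[OF K]])
    fix y u assume y: "y \<in> commutant M"
    obtain s where "s \<in> commutant M" "adjoint_pair y s" using commutant_adjoint[OF y] by blast
    then show "y (cproj K u) = cproj K (y u)"
      using cproj_commutes[OF K commutant_bounded[OF y], of s] inv y by simp
  qed
  then show ?thesis
    using adjoint_pair_cproj[OF K] cproj_fixes[OF K cproj_mem[OF K]]
    by (auto simp: projections_def)
qed

lemma cproj_kernel_in_projections:
  assumes S: "S \<in> M" shows "cproj {u. S u = 0} \<in> projections M"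
proof (rule cproj_in_projections)
  show "y k \<in> {u. S u = 0}" if "y \<in> commutant M" "k \<in> {u. S u = 0}" for y k
    using that commutant_commutes[OF _ S] bounded_clinear_zero[OF commutant_bounded] by fastforce
qed (use bounded_clinear_closed_kernel[OF M_bounded[OF S]] in auto)

lemma projection_in_M: "p \<in> projections M \<Longrightarrow> p \<in> M"
  by (simp add: projections_def)

lemma projection_idem: "p \<in> projections M \<Longrightarrow> p (p u) = p u"
  by (auto simp: projections_def fun_eq_iff)

lemma projection_selfadjoint: "p \<in> projections M \<Longrightarrow> cinner (p u) v = cinner u (p v)"
  by (auto simp: projections_def adjoint_pair_def)

lemma projection_range_iff: "p \<in> projections M \<Longrightarrow> u \<in> range p \<longleftrightarrow> p u = u"
  using projection_idem by (metis rangeE rangeI)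

lemma projection_bounded: "p \<in> projections M \<Longrightarrow> bounded_clinear p"
  by (simp add: M_bounded projection_in_M)

lemma perp_projection: assumes p: "p \<in> projections M" shows "perp p \<in> projections M"
proof -
  have "adjoint_pair (perp p) (perp p)"
    by (simp add: adjoint_pair_def perp_def cinner_linear projection_selfadjoint[OF p])
  moreover have "perp p \<circ> perp p = perp p"
    by (auto simp: perp_def bounded_clinear_diff[OF projection_bounded[OF p]] projection_idem[OF p])
  ultimately show ?thesis using M_perp projection_in_M[OF p] by (simp add: projections_def)
qed

lemma projection_range:
  assumes p: "p \<in> projections M"
  shows "csubspace (range p)" "closed (range p)"
    "\<And>y k. y \<in> commutant M \<Longrightarrow> k \<in> range p \<Longrightarrow> y k \<in> range p"
proof -
  have eq: "range p = {u. perp p u = 0}"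
    by (rule set_eqI) (unfold projection_range_iff[OF p], auto simp: perp_def)
  show "csubspace (range p)" "closed (range p)"
    unfolding eq by (intro bounded_clinear_closed_kernel M_bounded M_perp projection_in_M p)+
  show "y k \<in> range p" if "y \<in> commutant M" "k \<in> range p" for y k
    using that commutant_commutes[OF _ projection_in_M[OF p]] by (metis projection_range_iff[OF p])
qed

lemma projection_eq_cproj: assumes p: "p \<in> projections M" shows "p = cproj (range p)"
proof
  fix u
  have "cinner (u - p u) m = 0" if "m \<in> range p" for m
  proof -
    have "p m = m" using that projection_range_iff[OF p] by blast
    then show ?thesis using projection_selfadjoint[OF p, of u m] by (simp add: cinner_diff_left)
  qed
  then show "p u = cproj (range p) u"
    by (intro cproj_unique[symmetric] projection_range(1,2)[OF p] rangeI)
qed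

lemma norm_projection_le: assumes p: "p \<in> projections M" shows "norm (p u) \<le> norm u"
  using norm_cproj_le[OF projection_range(1,2)[OF p]] projection_eq_cproj[OF p] by metis

lemma cinner_projection: "p \<in> projections M \<Longrightarrow> Re (cinner (p u) u) = (norm (p u))\<^sup>2"
  by (metis projection_idem projection_selfadjoint power2_norm_eq_cinner)

lemma pos_cone_selfadjoint:
  "T \<in> M \<Longrightarrow> adjoint_pair T T \<Longrightarrow> (\<And>u. 0 \<le> Re (cinner (T u) u)) \<Longrightarrow> T \<in> pos_cone M"
  by (simp add: pos_cone_def positive_op_selfadjoint)

lemma projection_pos_cone: "p \<in> projections M \<Longrightarrow> p \<in> pos_cone M"
  by (rule pos_cone_selfadjoint) (auto simp: cinner_projection projections_def)

lemma op_le_iff: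
  assumes "S \<in> pos_cone M" "T \<in> pos_cone M"
  shows "op_le S T \<longleftrightarrow> (\<forall>u. Re (cinner (S u) u) \<le> Re (cinner (T u) u))"
  using assms by (auto simp: op_le_def positive_op_def pos_cone_def cinner_diff_left)

end


section \<open>Traces of support projections\<close>

text \<open>For a positive contraction \<open>X\<close> these operators decrease to the projection onto its kernel.
  For \<open>X = T T\<^sup>*\<close> the decrement \<open>g X g\<close> equals \<open>V V\<^sup>*\<close> with \<open>V = g T\<close>, so the trace property
  applies to it without square roots of operators.\<close>

primrec resid :: "('a::ab_group_add \<Rightarrow> 'a) \<Rightarrow> nat \<Rightarrow> 'a \<Rightarrow> 'a" where
  "resid X 0 = (\<lambda>u. u)"
| "resid X (Suc n) = (\<lambda>u. resid X n u - resid X n (X (resid X n u)))"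

context vN_algebra
begin

lemma resid_in_M: "X \<in> M \<Longrightarrow> resid X n \<in> M"
proof (induction n)
  case (Suc n)
  have "(\<lambda>u. resid X n u - (resid X n \<circ> X \<circ> resid X n) u) \<in> M"
    using Suc by (intro M_sub M_comp) auto
  then show ?case by (simp add: o_def)
qed (simp add: M_id)

lemma resid_selfadjoint: "adjoint_pair X X \<Longrightarrow> adjoint_pair (resid X n) (resid X n)"
  by (induction n) (auto simp: adjoint_pair_def cinner_linear)

lemma resid_kernel: "X \<in> M \<Longrightarrow> X u = 0 \<Longrightarrow> resid X n u = u"
proof (induction n)
  case (Suc n)
  then show ?case using bounded_clinear_zero[OF M_bounded[OF resid_in_M[OF Suc(2)]]] by simp
qed simp

text \<open>For \<open>0 \<le> g \<le> 1\<close> we have \<open>g - g\<^sup>2 = (1 - g) g (1 - g) + g (1 - g) g \<ge> 0\<close>.\<close>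

lemma positive_contraction_square_le:
  assumes g: "g \<in> M" "adjoint_pair g g"
    and pos: "\<And>u. 0 \<le> Re (cinner (g u) u)" and le1: "\<And>u. Re (cinner (g u) u) \<le> (norm u)\<^sup>2"
  shows "(norm (g u))\<^sup>2 \<le> Re (cinner (g u) u)"
proof -
  let ?h = "u - g u"
  have sa: "cinner (g (g u)) u = cinner (g u) (g u)" using g(2) by (simp add: adjoint_pair_def)
  have "Re (cinner (g ?h) ?h)
      = Re (cinner (g u) u) - 2 * (norm (g u))\<^sup>2 + Re (cinner (g (g u)) (g u))"
    by (simp add: bounded_clinear_diff[OF M_bounded[OF g(1)]] cinner_linear sa power2_norm_eq_cinner)
  then show ?thesis using pos[of ?h] le1[of "g u"] by simp
qed

lemma resid_bounds:
  assumes X: "X \<in> M" "adjoint_pair X X"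
    and pos: "\<And>u. 0 \<le> Re (cinner (X u) u)" and le1: "\<And>u. Re (cinner (X u) u) \<le> (norm u)\<^sup>2"
  shows resid_pos: "0 \<le> Re (cinner (resid X n u) u)"
    and resid_le1: "Re (cinner (resid X n u) u) \<le> (norm u)\<^sup>2"
    and resid_Suc_cinner: "Re (cinner (resid X (Suc n) u) u)
      = Re (cinner (resid X n u) u) - Re (cinner (X (resid X n u)) (resid X n u))"
    and norm_resid_le: "norm (resid X n u) \<le> norm u"
proof -
  have step: "Re (cinner (resid X (Suc n) u) u)
      = Re (cinner (resid X n u) u) - Re (cinner (X (resid X n u)) (resid X n u))" for n u
    using resid_selfadjoint[OF X(2), of n] by (simp add: cinner_linear adjoint_pair_def)
  have main: "0 \<le> Re (cinner (resid X n u) u) \<and> Re (cinner (resid X n u) u) \<le> (norm u)\<^sup>2" for n u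
  proof (induction n arbitrary: u)
    case 0
    then show ?case by (simp add: cinner_ge_zero power2_norm_eq_cinner)
  next
    case (Suc n)
    have "(norm (resid X n u))\<^sup>2 \<le> Re (cinner (resid X n u) u)"
      using Suc by (intro positive_contraction_square_le resid_in_M resid_selfadjoint X) auto
    then show ?case using Suc[of u] pos[of "resid X n u"] le1[of "resid X n u"] unfolding step by simp
  qed
  show "0 \<le> Re (cinner (resid X n u) u)" "Re (cinner (resid X n u) u) \<le> (norm u)\<^sup>2"
    using main by auto
  show "Re (cinner (resid X (Suc n) u) u)
      = Re (cinner (resid X n u) u) - Re (cinner (X (resid X n u)) (resid X n u))" by (rule step)
  have "(norm (resid X n u))\<^sup>2 \<le> (norm u)\<^sup>2"
    using positive_contraction_square_le[OF resid_in_M[OF X(1)] resid_selfadjoint[OF X(2)], of n u] main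
    by (meson order_trans)
  then show "norm (resid X n u) \<le> norm u" by (rule power2_le_imp_le) simp
qed

lemma perp_resid_pos_cone:
  assumes X: "X \<in> M" "adjoint_pair X X"
    and "\<And>u. 0 \<le> Re (cinner (X u) u)" "\<And>u. Re (cinner (X u) u) \<le> (norm u)\<^sup>2"
  shows "perp (resid X n) \<in> pos_cone M"
proof (rule pos_cone_selfadjoint)
  show "perp (resid X n) \<in> M" by (intro M_perp resid_in_M X)
  show "adjoint_pair (perp (resid X n)) (perp (resid X n))"
    using resid_selfadjoint[OF X(2), of n] by (simp add: adjoint_pair_def perp_def cinner_linear)
  show "0 \<le> Re (cinner (perp (resid X n) u) u)" for u
    using resid_le1[OF assms, of n u] by (simp add: perp_def cinner_linear power2_norm_eq_cinner)
qed

end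

locale vN_algebra_pair = vN_algebra M for M :: "('h::complex_hilbert \<Rightarrow> 'h) set" +
  fixes T S :: "'h \<Rightarrow> 'h"
  assumes TM: "T \<in> M" and SM: "S \<in> M" and TS: "adjoint_pair T S"
    and contraction: "norm (T u) \<le> norm u"
begin

lemma ST: "adjoint_pair S T" by (rule adjoint_pair_sym[OF TS])

lemma contraction_adjoint: "norm (S u) \<le> norm u"
proof (cases "S u = 0")
  case False
  have "(norm (S u))\<^sup>2 = Re (cinner (T (S u)) u)"
    using TS by (simp add: adjoint_pair_def power2_norm_eq_cinner)
  also have "\<dots> \<le> norm (T (S u)) * norm u"
    using Cauchy_Schwarz_cinner complex_Re_le_cmod order_trans by blast
  also have "\<dots> \<le> norm (S u) * norm u" by (intro mult_right_mono contraction) simp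
  finally show ?thesis using False by (simp add: power2_eq_square)
qed simp

lemma TS_facts: "T \<circ> S \<in> M" "adjoint_pair (T \<circ> S) (T \<circ> S)"
  "0 \<le> Re (cinner ((T \<circ> S) u) u)" "Re (cinner ((T \<circ> S) u) u) \<le> (norm u)\<^sup>2"
  "cinner ((T \<circ> S) u) u = cinner (S u) (S u)"
proof -
  show "T \<circ> S \<in> M" by (intro M_comp TM SM)
  show "adjoint_pair (T \<circ> S) (T \<circ> S)" using TS ST by (simp add: adjoint_pair_def)
  show *: "cinner ((T \<circ> S) u) u = cinner (S u) (S u)" using TS by (simp add: adjoint_pair_def)
  show "0 \<le> Re (cinner ((T \<circ> S) u) u)" "Re (cinner ((T \<circ> S) u) u) \<le> (norm u)\<^sup>2"
    unfolding * using contraction_adjoint[of u] by (simp_all add: cinner_self power_mono)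
qed

text \<open>The instance \<open>p(T T\<^sup>*) T = T p(T\<^sup>* T)\<close> for the polynomials \<open>p\<close> behind \<open>resid\<close>.\<close>

lemma resid_intertwine: "resid (T \<circ> S) n (T u) = T (resid (S \<circ> T) n u)"
proof (induction n arbitrary: u)
  case (Suc n)
  then show ?case by (simp add: bounded_clinear_diff[OF M_bounded[OF TM]])
qed simp

text \<open>Weakly, \<open>1 - g\<^sub>n\<close> tends to the range projection of \<open>T\<close>. On the range of \<open>T\<close>, \<open>g\<^sub>n\<close> tends to
  \<open>0\<close> weakly: \<open>\<langle>g\<^sub>n (T v), w\<rangle> = \<langle>v, S (g\<^sub>n w)\<rangle>\<close>, and \<open>\<parallel>S (g\<^sub>n w)\<parallel>\<^sup>2\<close> is the decrement of the
  convergent sequence \<open>\<langle>g\<^sub>n w, w\<rangle>\<close>.\<close>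

lemma resid_tendsto_kernel_projection:
  defines "r \<equiv> cproj {u. S u = 0}"
  shows "(\<lambda>n. Re (cinner (perp (resid (T \<circ> S) n) u) u)) \<longlonglongrightarrow> Re (cinner (perp r u) u)"
proof -
  let ?g = "resid (T \<circ> S)"
  have ker: "csubspace {u. S u = 0}" "closed {u. S u = 0}"
    using bounded_clinear_closed_kernel[OF M_bounded[OF SM]] by auto
  have r: "r \<in> projections M" unfolding r_def by (rule cproj_kernel_in_projections[OF SM])
  have Sr: "S (r v) = 0" for v using cproj_mem[OF ker, of v] by (simp add: r_def)
  define w where "w = perp r u"
  have uw: "u = r u + w" by (simp add: w_def perp_def)
  have rw: "r w = 0"
    by (simp add: w_def perp_def bounded_clinear_diff[OF projection_bounded[OF r]] projection_idem[OF r])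
  let ?K = "closure (range T)"
  have "csubspace (range T)" by (rule csubspace_range[OF M_bounded[OF TM]])
  then have K: "csubspace ?K" "closed ?K" by (auto intro: csubspace_closure)
  \<comment> \<open>The orthogonal complement of the kernel of \<open>S\<close> is the closure of the range of \<open>T\<close>.\<close>
  have "w \<in> ?K"
  proof -
    define z where "z = w - cproj ?K w"
    have "cinner v (S z) = 0" for v
    proof -
      have "cinner z (T v) = 0"
        unfolding z_def by (intro cproj_orthogonal[OF K] subsetD[OF closure_subset] rangeI)
      then have "cinner (T v) z = 0" by (metis cinner_commute complex_cnj_zero)
      then show ?thesis using TS by (simp add: adjoint_pair_def)
    qed
    then have "S z = 0" by (metis cinner_self_eq_0)
    then have "r z = z" unfolding r_def by (intro cproj_fixes[OF ker]) simp
    moreover have "?K \<subseteq> {v. r v = 0}"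
    proof (rule closure_minimal)
      have "cinner z (r (T v)) = 0" for v z
        using projection_selfadjoint[OF r, of z "T v"] ST Sr by (metis adjoint_pair_def cinner_zero_left)
      then show "range T \<subseteq> {v. r v = 0}" by (auto simp: eq_iff_cinner_left[of _ 0])
      show "closed {v. r v = 0}" by (rule bounded_clinear_closed_kernel[OF projection_bounded[OF r]])
    qed
    then have "r (cproj ?K w) = 0" using cproj_mem[OF K] by blast
    ultimately have "z = 0"
      using rw by (simp add: z_def bounded_clinear_diff[OF projection_bounded[OF r]])
    then show ?thesis using cproj_mem[OF K, of w] by (simp add: z_def)
  qed
  have S0: "(\<lambda>n. S (?g n w)) \<longlonglongrightarrow> 0"
  proof -
    let ?a = "\<lambda>n. Re (cinner (?g n w) w)"
    have dec: "?a (Suc n) = ?a n - (norm (S (?g n w)))\<^sup>2" for n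
      by (simp only: resid_Suc_cinner[OF TS_facts(1-4)] TS_facts(5) power2_norm_eq_cinner)
    have "decseq ?a" by (rule decseq_SucI) (simp only: dec, simp)
    then obtain L where L: "?a \<longlonglongrightarrow> L"
      by (rule decseq_convergent[where B = 0]) (intro allI resid_pos[OF TS_facts(1-4)])
    have "(\<lambda>n. ?a n - ?a (Suc n)) \<longlonglongrightarrow> L - L"
      by (intro tendsto_diff L LIMSEQ_Suc)
    then have "(\<lambda>n. (norm (S (?g n w)))\<^sup>2) \<longlonglongrightarrow> 0" unfolding dec by simp
    then have "(\<lambda>n. sqrt ((norm (S (?g n w)))\<^sup>2)) \<longlonglongrightarrow> sqrt 0" by (rule tendsto_real_sqrt)
    then show ?thesis by (simp add: tendsto_norm_zero_iff)
  qed
  have "(\<lambda>n. cinner w (?g n w)) \<longlonglongrightarrow> 0"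
  proof (rule LIMSEQ_I)
    fix e :: real assume e: "e > 0"
    define d where "d = e / (2 * (norm w + 1))"
    have d: "d > 0" using e by (simp add: d_def add_nonneg_pos)
    obtain v where v: "dist (T v) w < d" using \<open>w \<in> ?K\<close> d by (auto simp: closure_approachable)
    have "(\<lambda>n. cinner v (S (?g n w))) \<longlonglongrightarrow> cinner v 0"
      by (rule bounded_linear.tendsto[OF bounded_linear_cinner_right S0])
    then obtain N where N: "\<And>n. n \<ge> N \<Longrightarrow> cmod (cinner v (S (?g n w))) < e / 2"
      using LIMSEQ_D[of _ 0 "e / 2"] e by auto
    have "norm (cinner w (?g n w) - 0) < e" if "n \<ge> N" for n
    proof -
      have "cinner w (?g n w) = cinner (w - T v) (?g n w) + cinner v (S (?g n w))"
        using TS by (simp add: cinner_linear adjoint_pair_def)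
      moreover have "cmod (cinner (w - T v) (?g n w)) \<le> d * (norm w + 1)"
      proof (rule order_trans[OF Cauchy_Schwarz_cinner], rule mult_mono)
        show "norm (w - T v) \<le> d" using v by (simp add: dist_norm norm_minus_commute)
        have "norm (?g n w) \<le> norm w" by (rule norm_resid_le[OF TS_facts(1-4)])
        then show "norm (?g n w) \<le> norm w + 1" by linarith
      qed (use d in auto)
      moreover have "d * (norm w + 1) = e / 2"
        by (simp add: d_def field_simps add_nonneg_eq_0_iff)
      ultimately show ?thesis using N[OF that] norm_triangle_ineq[of "cinner (w - T v) (?g n w)" "cinner v (S (?g n w))"]
        by simp
    qed
    then show "\<exists>no. \<forall>n\<ge>no. norm (cinner w (?g n w) - 0) < e" by blast
  qed
  then have "(\<lambda>n. (norm w)\<^sup>2 - Re (cinner w (?g n w))) \<longlonglongrightarrow> (norm w)\<^sup>2 - Re 0"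
    by (intro tendsto_intros)
  moreover have "Re (cinner (perp (?g n) u) u) = (norm w)\<^sup>2 - Re (cinner w (?g n w))" for n
  proof -
    have P: "perp (?g n) \<in> M" by (intro M_perp resid_in_M TS_facts)
    have sa: "cinner (perp (?g n) v) z = cinner v (perp (?g n) z)" for v z
      using resid_selfadjoint[OF TS_facts(2), of n] by (simp add: adjoint_pair_def perp_def cinner_linear)
    have "(T \<circ> S) (r u) = 0" by (simp add: Sr bounded_clinear_zero[OF M_bounded[OF TM]])
    then have 0: "perp (?g n) (r u) = 0"
      using resid_kernel[OF TS_facts(1)] by (simp add: perp_def)
    have Pu: "perp (?g n) u = perp (?g n) w"
      using bounded_clinear_add[OF M_bounded[OF P], of "r u" w] 0 uw by simp
    have "cinner (perp (?g n) u) u = cinner (perp (?g n) w) u" unfolding Pu ..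
    also have "\<dots> = cinner w (perp (?g n) w)" unfolding sa[of w u] Pu ..
    finally show ?thesis by (simp add: perp_def[of "?g n"] cinner_linear power2_norm_eq_cinner)
  qed
  moreover have "Re (cinner (perp r u) u) = (norm w)\<^sup>2"
    using cinner_projection[OF perp_projection[OF r]] by (simp add: w_def)
  ultimately show ?thesis by simp
qed

end

locale trace_algebra = vN_algebra M for M :: "('h::complex_hilbert \<Rightarrow> 'h) set" +
  fixes \<tau> :: "('h \<Rightarrow> 'h) \<Rightarrow> ennreal"
  assumes trace: "is_trace M \<tau>" and normal: "normal_trace M \<tau>"
begin

lemma trace_add: "S \<in> pos_cone M \<Longrightarrow> T \<in> pos_cone M \<Longrightarrow> \<tau> (\<lambda>x. S x + T x) = \<tau> S + \<tau> T"
  using trace by (auto simp: is_trace_def)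

lemma trace_adjoint: "S \<in> M \<Longrightarrow> T \<in> M \<Longrightarrow> adjoint_pair S T \<Longrightarrow> \<tau> (T \<circ> S) = \<tau> (S \<circ> T)"
  using trace by (auto simp: is_trace_def)

lemma trace_mono:
  assumes "S \<in> pos_cone M" "T \<in> pos_cone M" "op_le S T" shows "\<tau> S \<le> \<tau> T"
proof -
  have "(\<lambda>x. T x - S x) \<in> pos_cone M"
    using assms M_sub by (auto simp: pos_cone_def op_le_def)
  from trace_add[OF assms(1) this] show ?thesis by simp
qed

text \<open>Convergence of the quadratic forms makes \<open>T\<close> the least upper bound of the increasing sequence,
  and normality applies.\<close>

lemma trace_increasing_limit:
  assumes S: "\<And>n. S n \<in> pos_cone M" and T: "T \<in> pos_cone M"
    and mono: "\<And>n. op_le (S n) (S (Suc n))"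
    and lim: "\<And>u. (\<lambda>n. Re (cinner (S n u) u)) \<longlonglongrightarrow> Re (cinner (T u) u)"
  shows "\<tau> T = (SUP n. \<tau> (S n))"
proof -
  have inc: "incseq (\<lambda>n. Re (cinner (S n u) u))" for u
    using mono by (intro incseq_SucI) (simp add: op_le_iff[OF S S])
  have le: "op_le (S m) (S n)" if "m \<le> n" for m n
    using incseqD[OF inc that] by (simp add: op_le_iff[OF S S])
  have ub: "op_le (S n) T" for n
    using incseq_le[OF inc lim] by (simp add: op_le_iff[OF S T])
  have lub: "op_le T U" if U: "U \<in> pos_cone M" "\<And>n. op_le (S n) U" for U
    using that LIMSEQ_le_const2[OF lim] by (simp add: op_le_iff[OF S] op_le_iff[OF T])
  have "\<forall>P\<in>range S. \<forall>Q\<in>range S. \<exists>U\<in>range S. op_le P U \<and> op_le Q U"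
  proof (intro ballI)
    fix P Q assume "P \<in> range S" "Q \<in> range S"
    then obtain m n where "P = S m" "Q = S n" by blast
    then show "\<exists>U\<in>range S. op_le P U \<and> op_le Q U"
      using le[of m "max m n"] le[of n "max m n"] by auto
  qed
  then have "\<tau> T = (SUP P\<in>range S. \<tau> P)"
    using normal S T ub lub unfolding normal_trace_def
    by (elim allE[of _ "range S"] allE[of _ T]) auto
  then show ?thesis by (simp add: image_comp o_def)
qed

end

locale trace_algebra_pair = trace_algebra M \<tau> + vN_algebra_pair M T S for M \<tau> T S
begin

sublocale swapped: vN_algebra_pair M S T
  by unfold_locales (auto intro: SM TM ST contraction_adjoint)

text \<open>The increments of the two sequences are \<open>V V\<^sup>*\<close> and \<open>V\<^sup>* V\<close> for the same \<open>V\<close>.\<close>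

lemma trace_resid_swap: "\<tau> (perp (resid (T \<circ> S) n)) = \<tau> (perp (resid (S \<circ> T) n))"
proof (induction n)
  case 0
  then show ?case by (simp add: perp_def)
next
  case (Suc n)
  let ?g = "resid (T \<circ> S) n" and ?g' = "resid (S \<circ> T) n"
  let ?V = "?g \<circ> T" and ?W = "S \<circ> ?g"
  have gM: "?g \<in> M" "?g' \<in> M" by (auto intro: resid_in_M TS_facts swapped.TS_facts)
  have VW: "?V \<in> M" "?W \<in> M" by (intro M_comp gM TM SM)+
  have adj: "adjoint_pair ?V ?W"
    using resid_selfadjoint[OF TS_facts(2), of n] TS by (simp add: adjoint_pair_def)
  have cone: "R \<circ> Q \<in> pos_cone M" if "R \<in> M" "Q \<in> M" "adjoint_pair R Q" for R Q
  proof (rule pos_cone_selfadjoint)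
    have "adjoint_pair Q R" by (rule adjoint_pair_sym[OF that(3)])
    then show "adjoint_pair (R \<circ> Q) (R \<circ> Q)" using that by (simp add: adjoint_pair_def)
    show "0 \<le> Re (cinner ((R \<circ> Q) u) u)" for u
      using that cinner_ge_zero by (simp add: adjoint_pair_def)
  qed (simp add: that M_comp)
  have 1: "perp (resid (T \<circ> S) (Suc n)) = (\<lambda>u. perp ?g u + (?V \<circ> ?W) u)"
    by (auto simp: perp_def)
  have 2: "perp (resid (S \<circ> T) (Suc n)) = (\<lambda>u. perp ?g' u + (?W \<circ> ?V) u)"
    by (auto simp: perp_def resid_intertwine swapped.resid_intertwine)
  have "\<tau> (perp (resid (T \<circ> S) (Suc n))) = \<tau> (perp ?g) + \<tau> (?V \<circ> ?W)"
    unfolding 1 by (intro trace_add perp_resid_pos_cone TS_facts cone VW adj)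
  also have "\<dots> = \<tau> (perp ?g') + \<tau> (?W \<circ> ?V)"
    unfolding Suc trace_adjoint[OF VW adj] ..
  also have "\<dots> = \<tau> (perp (resid (S \<circ> T) (Suc n)))"
    unfolding 2 by (intro trace_add[symmetric] perp_resid_pos_cone swapped.TS_facts cone VW
        adjoint_pair_sym[OF adj])
  finally show ?case .
qed

text \<open>The left support of \<open>T\<close> is \<open>perp (cproj {u. S u = 0})\<close> and is equivalent to its right support,
  which is dominated by \<open>perp q\<close>. Equality of the traces of the supports comes from
  approximating both by \<open>1 - g\<^sub>n\<close>, for \<open>T T\<^sup>*\<close> and for \<open>T\<^sup>* T\<close>.\<close>

lemma trace_left_support_le:
  assumes q: "q \<in> projections M" and Tq: "\<And>u. T (q u) = 0"
  shows "\<tau> (perp (cproj {u. S u = 0})) \<le> \<tau> (perp q)"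
proof -
  let ?f = "\<lambda>n. perp (resid (T \<circ> S) n)" and ?f' = "\<lambda>n. perp (resid (S \<circ> T) n)"
  have cone: "?f n \<in> pos_cone M" "?f' n \<in> pos_cone M" for n
    by (intro perp_resid_pos_cone TS_facts swapped.TS_facts)+
  have "\<tau> (perp (cproj {u. S u = 0})) = (SUP n. \<tau> (?f n))"
  proof (rule trace_increasing_limit[OF cone(1) _ _ resid_tendsto_kernel_projection])
    show "perp (cproj {u. S u = 0}) \<in> pos_cone M"
      by (intro projection_pos_cone perp_projection cproj_kernel_in_projections SM)
    show "op_le (?f n) (?f (Suc n))" for n
      unfolding op_le_iff[OF cone(1) cone(1)]
    proof
      fix u
      show "Re (cinner (?f n u) u) \<le> Re (cinner (?f (Suc n) u) u)"
        using resid_Suc_cinner[OF TS_facts(1-4), of n u] TS_facts(3)[of "resid (T \<circ> S) n u"]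
        unfolding perp_def cinner_diff_left minus_complex.simps by linarith
    qed
  qed
  also have "\<dots> = (SUP n. \<tau> (?f' n))" by (simp add: trace_resid_swap)
  also have "\<dots> \<le> \<tau> (perp q)"
  proof (rule SUP_least)
    fix n
    have sa: "cinner (?f' n v) z = cinner v (?f' n z)" for v z
      using resid_selfadjoint[OF swapped.TS_facts(2), of n]
      by (simp add: adjoint_pair_def perp_def cinner_linear)
    have "op_le (?f' n) (perp q)"
      unfolding op_le_iff[OF cone(2) projection_pos_cone[OF perp_projection[OF q]]]
    proof
      fix u
      define w where "w = perp q u"
      have "?f' n (q u) = 0"
        using resid_kernel[OF swapped.TS_facts(1), of "q u" n] Tq[of u]
        by (simp add: perp_def bounded_clinear_zero[OF M_bounded[OF SM]])
      moreover have "u = q u + w" by (simp add: w_def perp_def)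
      ultimately have fu: "?f' n u = ?f' n w"
        using bounded_clinear_add[OF M_bounded[OF M_perp[OF resid_in_M[OF swapped.TS_facts(1)]]], of n "q u" w]
        by simp
      have "cinner (?f' n u) u = cinner w (?f' n w)" by (metis fu sa)
      also have "Re \<dots> \<le> (norm w)\<^sup>2"
        using resid_pos[OF swapped.TS_facts(1-4), of n w]
          resid_selfadjoint[OF swapped.TS_facts(2), of n, unfolded adjoint_pair_def, rule_format, of w w]
        by (simp only: perp_def cinner_linear power2_norm_eq_cinner minus_complex.simps)
      also have "\<dots> = Re (cinner (perp q u) u)"
        using cinner_projection[OF perp_projection[OF q]] by (simp add: w_def)
      finally show "Re (cinner (?f' n u) u) \<le> Re (cinner (perp q u) u)" .
    qed
    then show "\<tau> (?f' n) \<le> \<tau> (perp q)"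
      by (intro trace_mono cone projection_pos_cone perp_projection q)
  qed
  finally show ?thesis .
qed

end


section \<open>Countable subadditivity of the trace\<close>

context trace_algebra
begin

text \<open>By Kaplansky's formula \<open>p - p \<and> q\<close> is the left support of \<open>p (1 - q)\<close>, whose right support
  lies below \<open>1 - q\<close>.\<close>

lemma trace_perp_inf:
  assumes p: "p \<in> projections M" and q: "q \<in> projections M" and e: "e \<in> projections M"
    and ran: "range e = range p \<inter> range q"
  shows "\<tau> (perp e) \<le> \<tau> (perp p) + \<tau> (perp q)"
proof -
  let ?T = "p \<circ> perp q" and ?S = "perp q \<circ> p"
  have q': "perp q \<in> projections M" by (rule perp_projection[OF q])
  interpret trace_algebra_pair M \<tau> ?T ?S
  proof unfold_locales
    show "?T \<in> M" "?S \<in> M" by (intro M_comp projection_in_M p q')+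
    show "adjoint_pair ?T ?S"
      by (simp add: adjoint_pair_def projection_selfadjoint[OF p] projection_selfadjoint[OF q'])
    show "norm (?T u) \<le> norm u" for u
      using norm_projection_le[OF p, of "perp q u"] norm_projection_le[OF q', of u] by simp
  qed
  let ?K = "{u. ?S u = 0}"
  have K: "csubspace ?K" "closed ?K" using bounded_clinear_closed_kernel[OF M_bounded[OF SM]] by auto
  have e_iff: "e v = v \<longleftrightarrow> p v = v \<and> q v = v" for v
    using ran projection_range_iff p q e by (metis Int_iff)
  have pe: "p (e v) = e v" and qe: "q (e v) = e v" for v using e_iff projection_idem[OF e] by auto
  have ep: "e (p v) = e v" for v
    by (subst eq_iff_cinner_left) (metis pe projection_selfadjoint p e)
  have perp_r: "perp (cproj ?K) u = p u - e u" for u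
  proof -
    have "cproj ?K u = u - p u + e u"
    proof (rule cproj_unique[OF K])
      show "u - p u + e u \<in> ?K"
        by (simp add: bounded_clinear_add[OF projection_bounded[OF p]]
            bounded_clinear_diff[OF projection_bounded[OF p]] projection_idem[OF p] pe perp_def qe)
      fix m assume "m \<in> ?K"
      then have "q (p m) = p m" by (simp add: perp_def)
      then have "e m = p m" using e_iff[of "p m"] projection_idem[OF p] ep by simp
      then show "cinner (u - (u - p u + e u)) m = 0"
        by (simp add: cinner_linear projection_selfadjoint[OF p] projection_selfadjoint[OF e])
    qed
    then show ?thesis by (simp add: perp_def)
  qed
  have "perp e = (\<lambda>u. perp p u + perp (cproj ?K) u)"
    unfolding perp_r by (auto simp: perp_def)
  then have "\<tau> (perp e) = \<tau> (perp p) + \<tau> (perp (cproj ?K))"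
    by (simp only:) (intro trace_add projection_pos_cone perp_projection p cproj_kernel_in_projections SM)
  also have "\<tau> (perp (cproj ?K)) \<le> \<tau> (perp q)"
  proof (rule trace_left_support_le[OF q])
    show "?T (q u) = 0" for u
      by (simp add: perp_def projection_idem[OF q] bounded_clinear_zero[OF projection_bounded[OF p]])
  qed
  finally show ?thesis by simp
qed

lemma inf_projection:
  assumes p: "p \<in> projections M" and q: "q \<in> projections M"
  shows "\<exists>e\<in>projections M. range e = range p \<inter> range q \<and> \<tau> (perp e) \<le> \<tau> (perp p) + \<tau> (perp q)"
proof -
  let ?K = "range p \<inter> range q"
  have K: "csubspace ?K" "closed ?K"
    by (intro csubspace_Int closed_Int projection_range(1,2) p q)+
  have e: "cproj ?K \<in> projections M"
    using projection_range(3)[OF p] projection_range(3)[OF q] by (intro cproj_in_projections K) blast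
  show ?thesis using trace_perp_inf[OF p q e range_cproj[OF K]] range_cproj[OF K] e by blast
qed

text \<open>The finite infima decrease strongly to the infimum of the whole sequence, so normality extends the
  bound for two projections to countably many.\<close>

lemma countable_inf_projection:
  fixes p :: "nat \<Rightarrow> 'h \<Rightarrow> 'h"
  assumes p: "\<And>n. p n \<in> projections M"
  shows "\<exists>e\<in>projections M. range e = (\<Inter>n. range (p n)) \<and> \<tau> (perp e) \<le> (\<Sum>n. \<tau> (perp (p n)))"
proof -
  define K where "K I = (\<Inter>n\<in>I. range (p n))" for I
  have K: "csubspace (K I)" "closed (K I)" for I
    unfolding K_def using projection_range[OF p] by (auto intro!: csubspace_INT closed_INT)
  have proj: "cproj (K I) \<in> projections M" for I
    using K projection_range(3)[OF p] by (intro cproj_in_projections) (auto simp: K_def)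
  let ?e = "\<lambda>n. cproj (K {..n})" and ?E = "cproj (K UNIV)"
  have sub: "K {..n} \<subseteq> K {..m}" "K UNIV \<subseteq> K {..m}" if "m \<le> n" for m n
    using that by (auto simp: K_def)
  have bound: "\<tau> (perp (?e n)) \<le> (\<Sum>i\<le>n. \<tau> (perp (p i)))" for n
  proof (induction n)
    case 0
    have "K {..0} = range (p 0)" by (simp add: K_def)
    then show ?case using projection_eq_cproj[OF p, of 0] by simp
  next
    case (Suc n)
    have "\<tau> (perp (?e (Suc n))) \<le> \<tau> (perp (?e n)) + \<tau> (perp (p (Suc n)))"
      using proj p by (rule trace_perp_inf) (rule proj, auto simp: range_cproj[OF K], auto simp: K_def atMost_Suc)
    also have "\<dots> \<le> (\<Sum>i\<le>Suc n. \<tau> (perp (p i)))" using Suc by (simp add: add_right_mono)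
    finally show ?case .
  qed
  have diff: "(norm (?e m u - ?e n u))\<^sup>2 = (norm (?e m u))\<^sup>2 - (norm (?e n u))\<^sup>2" if mn: "m \<le> n" for m n u
  proof -
    have "cinner (?e m u - ?e n u) (?e n u) = cinner (u - ?e n u) (?e n u) - cinner (u - ?e m u) (?e n u)"
      by (simp add: cinner_linear)
    also have "\<dots> = 0"
      using cproj_orthogonal[OF K cproj_mem[OF K]] cproj_orthogonal[OF K subsetD[OF sub(1)[OF mn] cproj_mem[OF K]]]
      by simp
    finally show ?thesis using Pythagoras_cinner[of "?e m u - ?e n u" "?e n u"] by simp
  qed
  have lim: "(\<lambda>n. ?e n u) \<longlonglongrightarrow> ?E u" for u
  proof -
    have dec: "decseq (\<lambda>n. (norm (?e n u))\<^sup>2)"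
      using diff by (intro decseq_SucI) (metis diff_ge_0_iff_ge lessI less_imp_le zero_le_power2)
    then obtain L where "(\<lambda>n. (norm (?e n u))\<^sup>2) \<longlonglongrightarrow> L"
      using decseq_convergent[of "\<lambda>n. (norm (?e n u))\<^sup>2" 0] by auto
    then have C: "Cauchy (\<lambda>n. (norm (?e n u))\<^sup>2)" by (rule LIMSEQ_imp_Cauchy)
    have "Cauchy (\<lambda>n. ?e n u)"
    proof (rule metric_CauchyI)
      fix d :: real assume d: "d > 0"
      obtain N where N: "\<And>m n. m \<ge> N \<Longrightarrow> n \<ge> N \<Longrightarrow> \<bar>(norm (?e m u))\<^sup>2 - (norm (?e n u))\<^sup>2\<bar> < d\<^sup>2"
        using CauchyD[OF C, of "d\<^sup>2"] d by auto
      have "dist (?e m u) (?e n u) < d" if "m \<ge> N" "n \<ge> N" for m n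
      proof (rule power2_less_imp_less)
        show "(dist (?e m u) (?e n u))\<^sup>2 < d\<^sup>2"
          using N[OF that] diff[of m n u] diff[of n m u]
          by (cases "m \<le> n") (simp_all add: dist_norm norm_minus_commute)
      qed (use d in simp)
      then show "\<exists>N. \<forall>m\<ge>N. \<forall>n\<ge>N. dist (?e m u) (?e n u) < d" by blast
    qed
    then obtain w where w: "(\<lambda>n. ?e n u) \<longlonglongrightarrow> w" using Cauchy_convergent_iff convergent_def by blast
    have "w \<in> range (p i)" for i
    proof (rule Lim_in_closed_set[OF projection_range(2)[OF p] _ _ w])
      have "?e n u \<in> range (p i)" if "n \<ge> i" for n
        using cproj_mem[OF K, of "{..n}" u] that by (auto simp: K_def)
      then show "\<forall>\<^sub>F n in sequentially. ?e n u \<in> range (p i)"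
        unfolding eventually_sequentially by blast
    qed simp
    then have "w \<in> K UNIV" by (simp add: K_def)
    moreover have "cinner (u - w) m = 0" if m: "m \<in> K UNIV" for m
    proof (rule LIMSEQ_unique)
      show "(\<lambda>n. cinner (u - ?e n u) m) \<longlonglongrightarrow> cinner (u - w) m"
        by (intro bounded_linear.tendsto[OF bounded_linear_cinner_left] tendsto_intros w)
      show "(\<lambda>n. cinner (u - ?e n u) m) \<longlonglongrightarrow> 0"
        using cproj_orthogonal[OF K subsetD[OF sub(2)[OF order_refl] m]] by simp
    qed
    ultimately show ?thesis using w cproj_unique[OF K] by metis
  qed
  have "\<tau> (perp ?E) = (SUP n. \<tau> (perp (?e n)))"
  proof (rule trace_increasing_limit)
    show cone: "perp (?e n) \<in> pos_cone M" for n by (intro projection_pos_cone perp_projection proj)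
    show "perp ?E \<in> pos_cone M" by (intro projection_pos_cone perp_projection proj)
    show "op_le (perp (?e n)) (perp (?e (Suc n)))" for n
      unfolding op_le_iff[OF cone cone]
    proof
      fix u
      have "(norm (?e (Suc n) u))\<^sup>2 \<le> (norm (?e n u))\<^sup>2"
        using diff[of n "Suc n" u] by (metis diff_ge_0_iff_ge lessI less_imp_le zero_le_power2)
      then show "Re (cinner (perp (?e n) u) u) \<le> Re (cinner (perp (?e (Suc n)) u) u)"
        by (simp add: perp_def cinner_linear cinner_projection[OF proj])
    qed
    show "(\<lambda>n. Re (cinner (perp (?e n) u) u)) \<longlonglongrightarrow> Re (cinner (perp ?E u) u)" for u
      unfolding perp_def
      by (intro tendsto_Re bounded_linear.tendsto[OF bounded_linear_cinner_left] tendsto_intros lim)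
  qed
  also have "\<dots> \<le> (\<Sum>n. \<tau> (perp (p n)))"
    by (rule SUP_least) (rule order_trans[OF bound sum_le_suminf], auto)
  finally show ?thesis
    using proj[of UNIV] range_cproj[OF K, of UNIV] by (intro bexI[of _ ?E]) (auto simp: K_def)
qed

end


section \<open>Measurable operators are bounded after left compression\<close>

text \<open>By Baire's theorem the closure of some sublevel set of \<open>\<parallel>T x\<parallel>\<close> contains a ball. Hence every \<open>x\<close>
  is approximated up to \<open>\<parallel>x\<parallel> / 2\<close> by vectors on which \<open>T\<close> is controlled. Iterating on the remainder
  represents \<open>x\<close> by a series whose image converges, and the image of its sum is identified by
  closedness of the graph.\<close>

lemma closed_graph_imp_bounded_linear:
  fixes T :: "'a::banach \<Rightarrow> 'b::banach"
  assumes lin: "linear T" and cl: "closed {(x, T x) |x. True}"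
  shows "bounded_linear T"
proof -
  define E where "E n = closure {x. norm (T x) \<le> real n}" for n
  have "\<exists>n. interior (E n) \<noteq> {}"
  proof (rule ccontr)
    assume "\<not> ?thesis"
    then have "euclidean interior_of (\<Union>(range E)) = {}"
      by (intro Baire_category_alt disjI1 completely_metrizable_space_euclidean)
        (auto simp: E_def)
    moreover have "x \<in> \<Union>(range E)" for x
    proof -
      obtain n where "norm (T x) \<le> real n" using real_arch_simple by blast
      then have "x \<in> E n" unfolding E_def by (intro subsetD[OF closure_subset]) simp
      then show ?thesis by blast
    qed
    then have "\<Union>(range E) = UNIV" by blast
    ultimately show False by simp
  qed
  then obtain n a where "a \<in> interior (E n)" by blast
  then obtain \<rho> where \<rho>: "\<rho> > 0" "ball a \<rho> \<subseteq> E n"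
    by (metis mem_interior)
  have approx: "\<exists>y. norm (T y) \<le> 2 * n \<and> norm (x - y) < d" if x: "norm x < \<rho>" and d: "d > 0" for x d
  proof -
    have "a + x \<in> E n" "a \<in> E n" using x \<rho> by (auto simp: dist_norm)
    then obtain y1 y2 where y: "norm (T y1) \<le> n" "dist y1 (a + x) < d / 2"
      "norm (T y2) \<le> n" "dist y2 a < d / 2"
      unfolding E_def closure_approachable using half_gt_zero[OF d] by blast
    have "norm (T (y1 - y2)) \<le> 2 * n"
      using y norm_triangle_ineq4[of "T y1" "T y2"] by (simp add: linear_diff[OF lin])
    moreover have "norm (x - (y1 - y2)) < d"
      using y norm_triangle_ineq4[of "y2 - a" "y1 - (a + x)"] by (simp add: dist_norm algebra_simps)
    ultimately show ?thesis by blast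
  qed
  define B where "B = 4 * real n / \<rho>"
  have B0: "B \<ge> 0" using \<rho> by (simp add: B_def)
  have "\<exists>y. norm (T y) \<le> B * norm x \<and> norm (x - y) \<le> norm x / 2" for x
  proof (cases "x = 0")
    case True
    then show ?thesis using linear_0[OF lin] by (intro exI[of _ 0]) simp
  next
    case False
    define c where "c = 2 * norm x / \<rho>"
    have c: "c > 0" using False \<rho> by (simp add: c_def)
    have "norm ((1 / c) *\<^sub>R x) < \<rho>" using False \<rho> by (simp add: c_def)
    from approx[OF this, of "\<rho> / 4"] \<rho>
    obtain y where y: "norm (T y) \<le> 2 * n" "norm ((1 / c) *\<^sub>R x - y) < \<rho> / 4" by auto
    have "x - c *\<^sub>R y = c *\<^sub>R ((1 / c) *\<^sub>R x - y)" using c by (simp add: scaleR_diff_right)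
    then have "norm (x - c *\<^sub>R y) = c * norm ((1 / c) *\<^sub>R x - y)" using c by simp
    also have "\<dots> \<le> c * (\<rho> / 4)" using y c by simp
    also have "\<dots> = norm x / 2" using \<rho> by (simp add: c_def)
    finally have "norm (x - c *\<^sub>R y) \<le> norm x / 2" .
    moreover have "norm (T (c *\<^sub>R y)) \<le> c * (2 * n)"
      using c y by (simp add: linear_scale[OF lin])
    then have "norm (T (c *\<^sub>R y)) \<le> B * norm x" using \<rho> by (simp add: c_def B_def field_simps)
    ultimately show ?thesis by blast
  qed
  then obtain \<phi> where \<phi>: "\<And>x. norm (T (\<phi> x)) \<le> B * norm x" "\<And>x. norm (x - \<phi> x) \<le> norm x / 2"
    by metis
  have "norm (T x) \<le> norm x * (2 * B)" for x
  proof -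
    define r where "r = rec_nat x (\<lambda>_ z. z - \<phi> z)"
    have r: "r 0 = x" "\<And>k. r (Suc k) = r k - \<phi> (r k)" by (auto simp: r_def)
    have nr: "norm (r k) \<le> norm x * (1/2) ^ k" for k
    proof (induction k)
      case (Suc k)
      then show ?case using \<phi>(2)[of "r k"] by (simp add: r)
    qed (simp add: r)
    let ?f = "\<lambda>k. T (\<phi> (r k))" and ?g = "\<lambda>k. B * norm x * (1/2) ^ k"
    have fg: "norm (?f k) \<le> ?g k" for k
      using order_trans[OF \<phi>(1)[of "r k"] mult_left_mono[OF nr B0]] by (simp add: mult.assoc)
    have g: "?g sums (B * norm x * 2)"
      using sums_mult[OF geometric_sums[of "1/2 :: real"], of "B * norm x"] by simp
    have nf: "summable (\<lambda>k. norm (?f k))"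
      by (rule summable_comparison_test'[OF sums_summable[OF g]]) (use fg in simp)
    then have sf: "summable ?f" by (rule summable_norm_cancel)
    have part: "T (x - r k) = (\<Sum>i<k. ?f i)" for k
    proof (induction k)
      case (Suc k)
      have "x - r (Suc k) = (x - r k) + \<phi> (r k)" by (simp add: r)
      then have "T (x - r (Suc k)) = T (x - r k) + T (\<phi> (r k))" by (simp only: linear_add[OF lin])
      then show ?case by (simp add: Suc)
    qed (simp add: r linear_0[OF lin])
    have "r \<longlonglongrightarrow> 0"
    proof (rule Lim_null_comparison)
      show "\<forall>\<^sub>F k in sequentially. norm (r k) \<le> norm x * (1/2) ^ k" using nr by simp
      show "(\<lambda>k. norm x * (1/2) ^ k) \<longlonglongrightarrow> 0" by (intro tendsto_mult_right_zero LIMSEQ_power_zero) simp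
    qed
    then have "(\<lambda>k. (x - r k, T (x - r k))) \<longlonglongrightarrow> (x - 0, suminf ?f)"
      unfolding part by (intro tendsto_intros summable_LIMSEQ sf)
    then have "(x, suminf ?f) \<in> {(x, T x) |x. True}"
      using closed_sequentially[OF cl, of "\<lambda>k. (x - r k, T (x - r k))"] by auto
    then have "norm (T x) = norm (suminf ?f)" by simp
    also have "\<dots> \<le> (\<Sum>k. norm (?f k))" by (rule summable_norm[OF nf])
    also have "\<dots> \<le> suminf ?g" by (rule suminf_le[OF fg nf sums_summable[OF g]])
    also have "\<dots> = norm x * (2 * B)" unfolding sums_unique[OF g, symmetric] by simp
    finally show ?thesis .
  qed
  then show ?thesis
    by (intro bounded_linear_intro[where K = "2 * B"])
      (auto simp: linear_add[OF lin] linear_scale[OF lin])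
qed

lemma (in vN_algebra) affiliated_commutant:
  assumes "affiliated M A" "y \<in> commutant M" "(u, v) \<in> A" shows "(y u, y v) \<in> A"
proof -
  have "(u, y v) \<in> A O op_graph y" using assms(3) by (auto simp: op_graph_def)
  then have "(u, y v) \<in> op_graph y O A" using assms unfolding affiliated_def by blast
  then show ?thesis by (auto simp: op_graph_def)
qed

lemma linear_operator_rules:
  assumes "linear_operator A"
  shows "csubspace A" "\<And>u v w. (u, v) \<in> A \<Longrightarrow> (u, w) \<in> A \<Longrightarrow> v = w"
  using assms by (auto simp: linear_operator_def csubspace_def scaleC_prod_def single_valued_def zero_prod_def)

text \<open>Compressing a measurable operator \<open>A\<close> on the right by \<open>q\<close> with range in its domain gives a
  bounded operator. On the left, the range of \<open>A (1 - q)\<close> has to be cut off, and its support must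
  be seen to be no larger than \<open>1 - q\<close> in trace. This support is that of the bounded operator
  \<open>T = pr\<^sub>2 P in\<^sub>1\<close> in \<open>M\<close>, where \<open>P\<close> projects the direct sum of two copies of the Hilbert space onto
  the graph \<open>G\<close> of \<open>A (1 - q)\<close>.\<close>

lemma (in trace_algebra) measurable_left_bounded:
  assumes A: "tau_measurable M \<tau> A" and \<epsilon>: "\<epsilon> > 0"
  shows "\<exists>r\<in>projections M. \<tau> (perp r) \<le> ennreal \<epsilon> \<and>
    (\<exists>B. \<forall>u v. (u, v) \<in> A \<longrightarrow> norm (r v) \<le> B * norm u)"
proof -
  obtain q where q: "q \<in> projections M" "\<tau> (perp q) \<le> ennreal \<epsilon>" "range q \<subseteq> Domain A"
    using A \<epsilon> unfolding tau_measurable_def by blast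
  have aff: "affiliated M A" using A by (simp add: tau_measurable_def)
  then have linA: "linear_operator A" and clA: "closed A"
    by (auto simp: affiliated_def closed_densely_defined_def)
  note A_sub = linear_operator_rules(1)[OF linA] and A_unique = linear_operator_rules(2)[OF linA]
  note qb = projection_bounded[OF q(1)]

  \<comment> \<open>The operator \<open>A q\<close> is everywhere defined and closed, hence bounded.\<close>
  have "\<exists>v. (q u, v) \<in> A" for u using q(3) by blast
  then obtain Q where Q: "\<And>u. (q u, Q u) \<in> A" by metis
  have "bounded_linear Q"
  proof (rule closed_graph_imp_bounded_linear)
    have "(q (u + v), Q u + Q v) \<in> A" "(q (c *\<^sub>C u), c *\<^sub>C Q u) \<in> A" for u v c
      using linA Q unfolding linear_operator_def
      by (auto simp: bounded_clinear_add[OF qb] bounded_clinear_scaleC[OF qb])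
    then show "linear Q"
      by (intro linearI) (auto simp: scaleR_scaleC intro: A_unique[OF Q])
    have "{(x, Q x) |x. True} = (\<lambda>z. (q (fst z), snd z)) -` A"
      using Q A_unique by auto
    then show "closed {(x, Q x) |x. True}"
      using clA by (auto intro!: continuous_closed_vimage continuous_intros
          continuous_on_compose2[OF bounded_clinear_continuous_on[OF qb, of UNIV]] simp: continuous_on_eq_continuous_at[symmetric])
  qed
  then obtain B where B: "\<And>u. norm (Q u) \<le> norm u * B" using bounded_linear.bounded by blast

  define G where "G = A \<inter> {z. q (fst z) = 0}"
  have G: "csubspace G" "closed G"
  proof -
    show "csubspace G"
      using A_sub by (auto simp: G_def csubspace_def scaleC_prod_def bounded_clinear_zero[OF qb]
          bounded_clinear_add[OF qb] bounded_clinear_scaleC[OF qb])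
    have "closed {z::'h \<times> 'h. q (fst z) = 0}"
      by (intro closed_Collect_eq continuous_on_const continuous_on_fst continuous_on_id
          continuous_on_compose2[OF bounded_clinear_continuous_on[OF qb, of UNIV]]) auto
    then show "closed G" unfolding G_def using clA by (rule closed_Int[rotated])
  qed
  have G_inv: "(y (fst z), y (snd z)) \<in> G" if y: "y \<in> commutant M" and z: "z \<in> G" for y z
    using z affiliated_commutant[OF aff y, of "fst z" "snd z"]
      commutant_commutes[OF y projection_in_M[OF q(1)], of "fst z"]
      bounded_clinear_zero[OF commutant_bounded[OF y]]
    by (auto simp: G_def)
  define T where "T u = snd (cproj G (u, 0))" for u
  note P = bounded_clinear_cproj[OF G]
  have T_clin: "bounded_clinear T"
  proof -
    have "bounded_linear T"
      unfolding T_def using P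
      by (intro bounded_linear_compose[OF bounded_linear_snd
            bounded_linear_compose[of "cproj G", OF _
              bounded_linear_Pair[OF bounded_linear_ident bounded_linear_zero]]])
        (simp add: bounded_clinear_def)
    moreover have "T (c *\<^sub>C u) = c *\<^sub>C T u" for c u
      using bounded_clinear_scaleC[OF P, of c "(u, 0)"] by (simp add: T_def scaleC_prod_def)
    ultimately show ?thesis by (simp add: bounded_clinear_def)
  qed
  have TM: "T \<in> M"
  proof (rule M_intro[OF T_clin])
    fix y u assume y: "y \<in> commutant M"
    obtain s where s: "s \<in> commutant M" "adjoint_pair y s" using commutant_adjoint[OF y] by blast
    let ?Y = "\<lambda>z::'h \<times> 'h. (y (fst z), y (snd z))" and ?S = "\<lambda>z::'h \<times> 'h. (s (fst z), s (snd z))"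
    note yb = commutant_bounded[OF y]
    have "bounded_clinear ?Y"
      using yb unfolding bounded_clinear_def
      by (simp add: scaleC_prod_def bounded_linear_Pair bounded_linear_compose[of y, OF _ bounded_linear_fst]
          bounded_linear_compose[of y, OF _ bounded_linear_snd])
    moreover have "adjoint_pair ?Y ?S" using s(2) by (simp add: adjoint_pair_def cinner_prod_def)
    ultimately have "cproj G (?Y (u, 0)) = ?Y (cproj G (u, 0))"
      using G_inv[OF y] G_inv[OF s(1)] by (intro cproj_commutes[OF G, where s = ?S]) auto
    then show "y (T u) = T (y u)" by (simp add: T_def bounded_clinear_zero[OF yb])
  qed
  obtain S where S: "S \<in> M" "adjoint_pair T S" using M_adjoint[OF TM] by blast
  have "norm (T u) \<le> norm u" for u
  proof -
    have "norm (T u) \<le> norm (cproj G (u, 0))" unfolding T_def by (metis norm_snd_le prod.collapse)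
    also have "\<dots> \<le> norm u" using norm_cproj_le[OF G, of "(u, 0)"] by (simp add: norm_Pair)
    finally show ?thesis .
  qed
  then interpret trace_algebra_pair M \<tau> T S using TM S by unfold_locales auto
  let ?r = "cproj {u. S u = 0}"
  have r: "?r \<in> projections M" by (rule cproj_kernel_in_projections[OF S(1)])
  have "T (q u) = 0" for u
  proof -
    have "cinner (q u, 0) z = 0" if "z \<in> G" for z
      using that projection_selfadjoint[OF q(1), of u "fst z"] by (auto simp: G_def cinner_prod_def)
    then show ?thesis using cproj_eq_0_iff[OF G, of "(q u, 0)"] by (simp add: T_def)
  qed
  then have "\<tau> (perp ?r) \<le> \<tau> (perp q)" by (rule trace_left_support_le[OF q(1)])
  then have small: "\<tau> (perp ?r) \<le> ennreal \<epsilon>" using q(2) by (rule order_trans)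

  \<comment> \<open>If \<open>S y = 0\<close>, then \<open>P (0, y)\<close> is orthogonal to the first summand, hence a point \<open>(0, b)\<close> of
    the graph, hence zero.\<close>
  have G_orth: "cinner v y = 0" if uv: "(u, v) \<in> G" and y: "S y = 0" for u v y
  proof -
    let ?z = "cproj G (0, y)"
    have "cinner h (fst ?z) = 0" for h
    proof -
      have "cinner h (fst ?z) = cinner (h, 0) ?z" by (simp add: cinner_prod_def)
      also have "\<dots> = cinner (cproj G (h, 0)) (0, y)"
        using adjoint_pair_cproj[OF G] by (simp add: adjoint_pair_def)
      also have "\<dots> = cinner h (S y)" using S(2) by (simp add: cinner_prod_def T_def adjoint_pair_def)
      finally show ?thesis using y by simp
    qed
    then have 1: "fst ?z = 0" by (metis cinner_self_eq_0)
    moreover have "?z \<in> A" using cproj_mem[OF G] by (auto simp: G_def)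
    ultimately have "snd ?z = 0"
      using A_unique[of 0 "snd ?z" 0] linA by (metis linear_operator_def prod.collapse)
    with 1 have "?z = 0" by (simp add: prod_eq_iff)
    then have "cinner (0, y) (u, v) = 0" using cproj_eq_0_iff[OF G] uv by blast
    then have "cinner y v = 0" by (simp add: cinner_prod_def)
    then show ?thesis by (metis cinner_commute complex_cnj_zero)
  qed
  have ker: "csubspace {u. S u = 0}" "closed {u. S u = 0}"
    using bounded_clinear_closed_kernel[OF M_bounded[OF S(1)]] by auto
  have rG: "?r v = 0" if "(u, v) \<in> G" for u v
    using G_orth[OF that] by (simp add: cproj_eq_0_iff[OF ker])
  \<comment> \<open>Since \<open>?r\<close> annihilates \<open>A (1 - q)\<close>, it satisfies \<open>?r A = ?r A q\<close> on the domain of \<open>A\<close>.\<close>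
  have "norm (?r v) \<le> B * norm u" if uv: "(u, v) \<in> A" for u v
  proof -
    have "(u, v) - (q u, Q u) \<in> A" using A_sub uv Q by (rule csubspace_diff)
    then have "(u - q u, v - Q u) \<in> G"
      by (simp add: G_def bounded_clinear_diff[OF qb] projection_idem[OF q(1)])
    then have "?r v = ?r (Q u)"
      using rG bounded_clinear_diff[OF projection_bounded[OF r]] by fastforce
    also have "norm \<dots> \<le> B * norm u"
      using norm_projection_le[OF r, of "Q u"] B[of u] by (simp add: mult.commute)
    finally show ?thesis .
  qed
  then show ?thesis using r small by blast
qed


section \<open>Compressions and strong differences\<close>

lemma compression_mem:
  assumes "(e u, w) \<in> A" shows "(u, e w) \<in> compression e A"
proof -
  have "(u, w) \<in> op_graph e O A" using assms by (auto simp: op_graph_def)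
  then have "(u, w) \<in> strong_product A (op_graph e)"
    unfolding strong_product_def by (rule subsetD[OF closure_subset])
  moreover have "(w, e w) \<in> op_graph e" by (auto simp: op_graph_def)
  ultimately have "(u, e w) \<in> strong_product A (op_graph e) O op_graph e" by blast
  then show ?thesis unfolding compression_def strong_product_def[of "op_graph e"]
    by (rule subsetD[OF closure_subset])
qed

text \<open>Multiples are needed because \<open>op_norm\<close> only looks at the unit ball; for \<open>u = 0\<close> large multiples
  force \<open>e w = 0\<close>.\<close>

lemma norm_le_op_norm_compression:
  assumes e: "bounded_clinear e" and A: "\<And>c. (c *\<^sub>R e u, c *\<^sub>R w) \<in> A"
    and B: "op_norm (compression e A) \<le> ennreal B" "B \<ge> 0"
  shows "norm (e w) \<le> B * norm u"
proof -
  have scale: "e (c *\<^sub>R v) = c *\<^sub>R e v" for c v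
    by (simp add: scaleR_scaleC bounded_clinear_scaleC[OF e])
  have *: "\<bar>c\<bar> * norm (e w) \<le> B" if "norm (c *\<^sub>R u) \<le> 1" for c
  proof -
    have "(c *\<^sub>R u, e (c *\<^sub>R w)) \<in> compression e A"
      using A[of c] by (intro compression_mem) (simp add: scale)
    then have "ennreal (norm (e (c *\<^sub>R w))) \<le> op_norm (compression e A)"
      unfolding op_norm_def using that by (intro SUP_upper2[of "(c *\<^sub>R u, e (c *\<^sub>R w))"]) auto
    then have "ennreal (norm (e (c *\<^sub>R w))) \<le> ennreal B" using B(1) by (rule order_trans)
    then show ?thesis using B(2) by (simp add: scale)
  qed
  show ?thesis
  proof (cases "u = 0")
    case True
    have "norm (e w) = 0"
    proof (rule ccontr)
      assume "norm (e w) \<noteq> 0"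
      then show False using *[of "(B + 1) / norm (e w)"] True B(2) by (simp add: abs_mult)
    qed
    then show ?thesis using True by simp
  next
    case False
    then show ?thesis using *[of "1 / norm u"] by (simp add: field_simps)
  qed
qed

text \<open>As \<open>A\<close> is closed and \<open>e\<close> continuous, \<open>A e\<close> is closed already, so only the outer closure in the
  compression matters, and a norm bound survives it.\<close>

lemma op_norm_compression_le:
  assumes e: "bounded_clinear e" and A: "closed A"
    and B: "\<And>u w. (e u, w) \<in> A \<Longrightarrow> norm (e w) \<le> B * norm u" "B \<ge> 0"
  shows "op_norm (compression e A) \<le> ennreal B"
proof -
  have "op_graph e O A = (\<lambda>z. (e (fst z), snd z)) -` A" by (auto simp: op_graph_def)
  moreover have "continuous_on UNIV (\<lambda>z::'a \<times> 'a. (e (fst z), snd z))"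
    by (intro continuous_intros continuous_on_compose2[OF bounded_clinear_continuous_on[OF e, of UNIV]]) auto
  ultimately have "closed (op_graph e O A)" using A by (simp add: closed_vimage)
  then have inner: "strong_product A (op_graph e) = op_graph e O A" by (simp add: strong_product_def)
  have "compression e A \<subseteq> {z. norm (snd z) \<le> B * norm (fst z)}"
    unfolding compression_def inner strong_product_def[of "op_graph e"]
  proof (rule closure_minimal)
    show "closed {z::'a \<times> 'a. norm (snd z) \<le> B * norm (fst z)}"
      by (intro closed_Collect_le continuous_intros)
  qed (auto simp: op_graph_def intro: B)
  then have "ennreal (norm v) \<le> ennreal B" if "(u, v) \<in> compression e A" "norm u \<le> 1" for u v
    using that B(2) by (intro ennreal_leI) (force intro: order_trans mult_left_le)
  then show ?thesis unfolding op_norm_def by (intro SUP_least) auto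
qed

lemma strong_sum_mem: "(u, v) \<in> A \<Longrightarrow> (u, w) \<in> B \<Longrightarrow> (u, v + w) \<in> strong_sum A B"
  unfolding strong_sum_def by (rule subsetD[OF closure_subset]) blast

lemma strong_diff_mem:
  assumes "(u, v) \<in> A" "(u, w) \<in> B" shows "(u, v - w) \<in> strong_diff A B"
proof -
  have "(u, (-1) *\<^sub>C w) \<in> strong_scale (-1) B"
    unfolding strong_scale_def by (rule subsetD[OF closure_subset]) (use assms(2) in blast)
  from strong_sum_mem[OF assms(1) this] show ?thesis
    by (simp add: strong_diff_def scaleC_minus_left)
qed

lemma closed_strong_diff: "closed (strong_diff A B)"
  by (simp add: strong_diff_def strong_sum_def)

text \<open>A strong difference is the closure of a sum of graphs, which for general \<open>A\<close> and \<open>B\<close> need not be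
  single-valued. The ambiguity disappears under any \<open>r\<close> for which \<open>r A\<close> and \<open>r B\<close> are bounded:
  then \<open>r (A - B)\<close> is Lipschitz at \<open>u0\<close>, a property that passes to the closure.\<close>

lemma strong_diff_left_bounded:
  assumes r: "bounded_clinear r" and A: "csubspace A" and B: "csubspace B"
    and a: "\<And>u v. (u, v) \<in> A \<Longrightarrow> norm (r v) \<le> a * norm u"
    and b: "\<And>u v. (u, v) \<in> B \<Longrightarrow> norm (r v) \<le> b * norm u"
    and mem: "(u0, v1) \<in> A" "(u0, v2) \<in> B" "(u0, w) \<in> strong_diff A B"
  shows "r w = r (v1 - v2)"
proof -
  have cont: "continuous_on UNIV (\<lambda>z::'a \<times> 'a. r (snd z))"
    by (intro continuous_intros continuous_on_compose2[OF bounded_clinear_continuous_on[OF r, of UNIV]]) auto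
  have "strong_scale (-1) B \<subseteq> {z. norm (r (snd z) + r v2) \<le> b * norm (fst z - u0)}"
    unfolding strong_scale_def
  proof (rule closure_minimal)
    have "norm (r ((-1) *\<^sub>C v) + r v2) \<le> b * norm (u - u0)" if "(u, v) \<in> B" for u v
    proof -
      have "(u - u0, v - v2) \<in> B" using csubspace_diff[OF B that mem(2)] by simp
      from b[OF this] show ?thesis
        by (simp add: scaleC_minus_left bounded_clinear_minus[OF r] bounded_clinear_diff[OF r] norm_minus_commute)
    qed
    then show "{(u, (-1) *\<^sub>C v) |u v. (u, v) \<in> B} \<subseteq> {z. norm (r (snd z) + r v2) \<le> b * norm (fst z - u0)}"
      by auto
  qed (intro closed_Collect_le continuous_intros cont)
  then have b': "norm (r v + r v2) \<le> b * norm (u - u0)" if "(u, v) \<in> strong_scale (-1) B" for u v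
    using that by auto
  have "strong_diff A B \<subseteq> {z. norm (r (snd z) - r (v1 - v2)) \<le> (a + b) * norm (fst z - u0)}"
    unfolding strong_diff_def strong_sum_def
  proof (rule closure_minimal)
    have "norm (r (v + v') - r (v1 - v2)) \<le> (a + b) * norm (u - u0)"
      if v: "(u, v) \<in> A" and v': "(u, v') \<in> strong_scale (-1) B" for u v v'
    proof -
      have "(u - u0, v - v1) \<in> A" using csubspace_diff[OF A v mem(1)] by simp
      then have "norm (r (v - v1)) \<le> a * norm (u - u0)" by (rule a)
      moreover have "r (v + v') - r (v1 - v2) = r (v - v1) + (r v' + r v2)"
        by (simp add: bounded_clinear_add[OF r] bounded_clinear_diff[OF r])
      ultimately show ?thesis
        using b'[OF v'] norm_triangle_ineq[of "r (v - v1)" "r v' + r v2"] by (simp add: distrib_right)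
    qed
    then show "{(u, v + w) |u v w. (u, v) \<in> A \<and> (u, w) \<in> strong_scale (-1) B}
        \<subseteq> {z. norm (r (snd z) - r (v1 - v2)) \<le> (a + b) * norm (fst z - u0)}" by auto
  qed (intro closed_Collect_le continuous_intros cont)
  then have "norm (r w - r (v1 - v2)) \<le> (a + b) * norm (u0 - u0)" using mem(3) by auto
  then show ?thesis by simp
qed


section \<open>Properties holding off small projections\<close>

context trace_algebra
begin

text \<open>The noncommutative analogue of "off a set of arbitrarily small measure": countably many
  hereditary properties that hold nearly hold nearly at the same time.\<close>

definition hereditary :: "(('h \<Rightarrow> 'h) \<Rightarrow> bool) \<Rightarrow> bool" where
  "hereditary P \<longleftrightarrow>
     (\<forall>p\<in>projections M. \<forall>e\<in>projections M. P p \<longrightarrow> range e \<subseteq> range p \<longrightarrow> P e)"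

definition nearly :: "(('h \<Rightarrow> 'h) \<Rightarrow> bool) \<Rightarrow> bool" where
  "nearly P \<longleftrightarrow> (\<forall>\<delta>>0. \<exists>e\<in>projections M. \<tau> (perp e) \<le> ennreal \<delta> \<and> P e)"

lemma subprojection:
  assumes "p \<in> projections M" "e \<in> projections M" "range e \<subseteq> range p"
  shows "p (e u) = e u" "e (p u) = e u"
proof -
  show *: "p (e v) = e v" for v using assms projection_range_iff[OF assms(1)] by blast
  show "e (p u) = e u"
    by (subst eq_iff_cinner_left) (metis * projection_selfadjoint assms(1,2))
qed

lemma hereditary_conj: "hereditary P \<Longrightarrow> hereditary Q \<Longrightarrow> hereditary (\<lambda>e. P e \<and> Q e)"
  unfolding hereditary_def by blast

lemma hereditary_all: "(\<And>i. hereditary (P i)) \<Longrightarrow> hereditary (\<lambda>e. \<forall>i. P i e)"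
  unfolding hereditary_def by blast

text \<open>Choose the \<open>i\<close>-th projection with complement of trace at most \<open>\<delta> / 2\<^sup>i\<^sup>+\<^sup>1\<close> and take the infimum.\<close>

lemma nearly_all:
  fixes P :: "nat \<Rightarrow> ('h \<Rightarrow> 'h) \<Rightarrow> bool"
  assumes her: "\<And>i. hereditary (P i)" and P: "\<And>i. nearly (P i)"
  shows "nearly (\<lambda>e. \<forall>i. P i e)"
  unfolding nearly_def
proof (intro allI impI)
  fix \<delta> :: real assume \<delta>: "\<delta> > 0"
  have "\<exists>p\<in>projections M. \<tau> (perp p) \<le> ennreal (\<delta> * (1/2) ^ Suc i) \<and> P i p" for i
    using P[of i] \<delta> unfolding nearly_def by simp
  then obtain p where p: "\<And>i. p i \<in> projections M" "\<And>i. \<tau> (perp (p i)) \<le> ennreal (\<delta> * (1/2) ^ Suc i)"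
    "\<And>i. P i (p i)" by metis
  obtain e where e: "e \<in> projections M" "range e = (\<Inter>i. range (p i))"
    "\<tau> (perp e) \<le> (\<Sum>i. \<tau> (perp (p i)))"
    using countable_inf_projection[of p] p(1) by blast
  note e(3)
  also have "(\<Sum>i. \<tau> (perp (p i))) \<le> (\<Sum>i. ennreal (\<delta> * (1/2) ^ Suc i))"
    by (intro suminf_le p) auto
  also have "\<dots> = ennreal \<delta>"
    using sums_mult[OF power_half_series, of \<delta>] \<delta> by (intro suminf_ennreal_eq) auto
  finally have "\<tau> (perp e) \<le> ennreal \<delta>" .
  moreover have "P i e" for i
    using her[of i] p e(1,2) unfolding hereditary_def by blast
  ultimately show "\<exists>e\<in>projections M. \<tau> (perp e) \<le> ennreal \<delta> \<and> (\<forall>i. P i e)" using e(1) by blast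
qed

lemma nearly_conj:
  assumes "hereditary P" "hereditary Q" "nearly P" "nearly Q"
  shows "nearly (\<lambda>e. P e \<and> Q e)"
proof -
  have "nearly (\<lambda>e. \<forall>i::nat. (if i = 0 then P else Q) e)"
    by (rule nearly_all) (use assms in auto)
  then show ?thesis unfolding nearly_def by (metis zero_neq_one)
qed

definition in_domain :: "'h operator \<Rightarrow> ('h \<Rightarrow> 'h) \<Rightarrow> bool" where
  "in_domain A e \<longleftrightarrow> range e \<subseteq> Domain A"

definition left_bounded :: "'h operator \<Rightarrow> ('h \<Rightarrow> 'h) \<Rightarrow> bool" where
  "left_bounded A e \<longleftrightarrow> (\<exists>B. \<forall>u v. (u, v) \<in> A \<longrightarrow> norm (e v) \<le> B * norm u)"

definition compressed_le :: "'h operator \<Rightarrow> real \<Rightarrow> ('h \<Rightarrow> 'h) \<Rightarrow> bool" where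
  "compressed_le A \<eta> e \<longleftrightarrow> (\<forall>u v. e u = u \<longrightarrow> (u, v) \<in> A \<longrightarrow> norm (e v) \<le> \<eta> * norm u)"

text \<open>This expresses smallness of the compressed differences \<open>e (z\<^sub>m - z\<^sub>n) e\<close> for late indices by
  graph elements over the range of \<open>e\<close> only, without closures.\<close>

definition oscillation_le :: "(nat \<Rightarrow> 'h operator) \<Rightarrow> real \<Rightarrow> ('h \<Rightarrow> 'h) \<Rightarrow> bool" where
  "oscillation_le z \<eta> e \<longleftrightarrow> (\<exists>N. \<forall>m\<ge>N. \<forall>n\<ge>N. \<forall>u v w.
     e u = u \<longrightarrow> (u, v) \<in> z m \<longrightarrow> (u, w) \<in> z n \<longrightarrow> norm (e (v - w)) \<le> \<eta> * norm u)"

lemma norm_subprojection_le: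
  assumes "p \<in> projections M" "e \<in> projections M" "range e \<subseteq> range p"
  shows "norm (e v) \<le> norm (p v)"
  using norm_projection_le[OF assms(2), of "p v"] subprojection(2)[OF assms] by simp

lemma hereditary_in_domain: "hereditary (in_domain A)"
  unfolding hereditary_def in_domain_def by blast

lemma hereditary_left_bounded: "hereditary (left_bounded A)"
  unfolding hereditary_def left_bounded_def by (meson norm_subprojection_le order_trans)

lemma hereditary_compressed_le: "hereditary (compressed_le A \<eta>)"
  unfolding hereditary_def compressed_le_def
  by (metis norm_subprojection_le subprojection(1) order_trans)

lemma hereditary_oscillation_le: "hereditary (oscillation_le z \<eta>)"
  unfolding hereditary_def
proof (intro ballI impI)
  fix p e assume pe: "p \<in> projections M" "e \<in> projections M" "range e \<subseteq> range p"
    and "oscillation_le z \<eta> p"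
  then obtain N where N: "\<And>m n u v w. m \<ge> N \<Longrightarrow> n \<ge> N \<Longrightarrow> p u = u \<Longrightarrow> (u, v) \<in> z m \<Longrightarrow> (u, w) \<in> z n \<Longrightarrow>
      norm (p (v - w)) \<le> \<eta> * norm u" unfolding oscillation_le_def by blast
  have "norm (e (v - w)) \<le> \<eta> * norm u"
    if "m \<ge> N" "n \<ge> N" "e u = u" "(u, v) \<in> z m" "(u, w) \<in> z n" for m n u v w
  proof -
    have "p u = u" using subprojection(1)[OF pe, of u] that(3) by simp
    from N[OF that(1,2) this that(4,5)] show ?thesis
      using norm_subprojection_le[OF pe, of "v - w"] by (rule order_trans[rotated])
  qed
  then show "oscillation_le z \<eta> e" unfolding oscillation_le_def by blast
qed

lemma nearly_in_domain: "A \<in> measurable_ops M \<tau> \<Longrightarrow> nearly (in_domain A)"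
  by (auto simp: nearly_def in_domain_def measurable_ops_def tau_measurable_def)

lemma nearly_left_bounded: "A \<in> measurable_ops M \<tau> \<Longrightarrow> nearly (left_bounded A)"
  using measurable_left_bounded by (auto simp: nearly_def left_bounded_def measurable_ops_def)

lemma measurable_ops_csubspace: "A \<in> measurable_ops M \<tau> \<Longrightarrow> csubspace A"
  and measurable_ops_unique: "A \<in> measurable_ops M \<tau> \<Longrightarrow> (u, v) \<in> A \<Longrightarrow> (u, w) \<in> A \<Longrightarrow> v = w"
  using linear_operator_rules[of A]
  by (auto simp: measurable_ops_def tau_measurable_def affiliated_def closed_densely_defined_def)

lemma compressed_le_of_op_norm:
  assumes e: "e \<in> projections M" and A: "csubspace A"
    and B: "op_norm (compression e A) \<le> ennreal \<eta>" "\<eta> \<ge> 0"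
  shows "compressed_le A \<eta> e"
  unfolding compressed_le_def
proof (intro allI impI)
  fix u v assume u: "e u = u" and "(u, v) \<in> A"
  then have "(c *\<^sub>R e u, c *\<^sub>R v) \<in> A" for c using csubspace_scaleR[OF A, of "(u, v)" c] by simp
  then show "norm (e v) \<le> \<eta> * norm u"
    by (intro norm_le_op_norm_compression[OF projection_bounded[OF e] _ B])
qed

lemma bau_cauchy_imp_nearly:
  assumes z: "\<And>n. z n \<in> measurable_ops M \<tau>" and c: "bau_cauchy M \<tau> z" and \<eta>: "\<eta> > 0"
  shows "nearly (oscillation_le z \<eta>)"
  unfolding nearly_def
proof (intro allI impI)
  fix \<delta> :: real assume "\<delta> > 0"
  then obtain e where e: "e \<in> projections M" "\<tau> (perp e) \<le> ennreal \<delta>"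
    and lim: "((\<lambda>i. op_norm (compression e (case i of (m, n) \<Rightarrow> strong_diff (z m) (z n)))) \<longlongrightarrow> 0)
      (sequentially \<times>\<^sub>F sequentially)"
    using c unfolding bau_cauchy_def bau_null_def by blast
  have "\<forall>\<^sub>F i in sequentially \<times>\<^sub>F sequentially.
      op_norm (compression e (case i of (m, n) \<Rightarrow> strong_diff (z m) (z n))) < ennreal \<eta>"
    using \<eta> by (intro order_tendstoD(2)[OF lim]) simp
  then obtain N where N: "\<And>m n. m \<ge> N \<Longrightarrow> n \<ge> N \<Longrightarrow>
      op_norm (compression e (strong_diff (z m) (z n))) < ennreal \<eta>"
    unfolding eventually_prod_sequentially by auto
  have "norm (e (v - w)) \<le> \<eta> * norm u"
    if mn: "m \<ge> N" "n \<ge> N" and u: "e u = u" and vw: "(u, v) \<in> z m" "(u, w) \<in> z n" for m n u v w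
  proof (rule norm_le_op_norm_compression[OF projection_bounded[OF e(1)]])
    show "(c *\<^sub>R e u, c *\<^sub>R (v - w)) \<in> strong_diff (z m) (z n)" for c
      using csubspace_scaleR[OF measurable_ops_csubspace[OF z] vw(1), of c]
        csubspace_scaleR[OF measurable_ops_csubspace[OF z] vw(2), of c] u
      by (simp add: scaleR_diff_right strong_diff_mem)
    show "op_norm (compression e (strong_diff (z m) (z n))) \<le> ennreal \<eta>"
      using N[OF mn] by (rule less_imp_le)
  qed (use \<eta> in simp)
  then show "\<exists>e\<in>projections M. \<tau> (perp e) \<le> ennreal \<delta> \<and> oscillation_le z \<eta> e"
    using e unfolding oscillation_le_def by blast
qed

text \<open>Domain and left boundedness conditions are imposed on \<open>e\<close> in addition, so that every element of a
  strong difference over the range of \<open>e\<close> is a pointwise difference after multiplication by \<open>e\<close>.\<close>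

lemma nearly_imp_bau_cauchy:
  assumes z: "\<And>n. z n \<in> measurable_ops M \<tau>"
    and osc: "\<And>\<eta>. \<eta> > 0 \<Longrightarrow> nearly (oscillation_le z \<eta>)"
  shows "bau_cauchy M \<tau> z"
proof -
  let ?P = "\<lambda>i e. oscillation_le z (inverse (real (Suc i))) e \<and> in_domain (z i) e \<and> left_bounded (z i) e"
  have "nearly (\<lambda>e. \<forall>i. ?P i e)"
    by (intro nearly_all nearly_conj hereditary_conj hereditary_oscillation_le hereditary_in_domain
        hereditary_left_bounded osc nearly_in_domain nearly_left_bounded z) simp
  moreover have "((\<lambda>i. op_norm (compression e (case i of (m, n) \<Rightarrow> strong_diff (z m) (z n)))) \<longlongrightarrow> 0)
      (sequentially \<times>\<^sub>F sequentially)"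
    if e: "e \<in> projections M" and P: "\<And>i. ?P i e" for e
  proof (rule order_tendstoI)
    fix a :: ennreal assume "0 < a"
    then obtain b where b: "0 < b" "b < a" using dense by blast
    then obtain s where s: "b = ennreal s" "s > 0"
      by (cases b) auto
    obtain i where i: "inverse (real (Suc i)) < s" using reals_Archimedean[OF s(2)] by blast
    obtain N where N: "\<And>m n u v w. m \<ge> N \<Longrightarrow> n \<ge> N \<Longrightarrow> e u = u \<Longrightarrow> (u, v) \<in> z m \<Longrightarrow> (u, w) \<in> z n \<Longrightarrow>
        norm (e (v - w)) \<le> inverse (real (Suc i)) * norm u"
      using P[of i] unfolding oscillation_le_def by blast
    have "op_norm (compression e (strong_diff (z m) (z n))) \<le> ennreal s" if mn: "m \<ge> N" "n \<ge> N" for m n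
    proof (rule op_norm_compression_le[OF projection_bounded[OF e] closed_strong_diff])
      fix u w assume w: "(e u, w) \<in> strong_diff (z m) (z n)"
      obtain v1 v2 where v: "(e u, v1) \<in> z m" "(e u, v2) \<in> z n"
        using P[of m] P[of n] unfolding in_domain_def by blast
      obtain a b where "\<And>u v. (u, v) \<in> z m \<Longrightarrow> norm (e v) \<le> a * norm u"
        "\<And>u v. (u, v) \<in> z n \<Longrightarrow> norm (e v) \<le> b * norm u"
        using P[of m] P[of n] unfolding left_bounded_def by blast
      then have "e w = e (v1 - v2)"
        using v w by (intro strong_diff_left_bounded[OF projection_bounded[OF e]
            measurable_ops_csubspace[OF z] measurable_ops_csubspace[OF z]])
      then have "norm (e w) \<le> inverse (real (Suc i)) * norm (e u)"
        using N[OF mn projection_idem[OF e] v] by simp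
      also have "\<dots> \<le> s * norm u" using i s(2) by (intro mult_mono norm_projection_le[OF e]) auto
      finally show "norm (e w) \<le> s * norm u" .
    qed (use s in simp)
    then have "\<And>m n. m \<ge> N \<Longrightarrow> n \<ge> N \<Longrightarrow> op_norm (compression e (strong_diff (z m) (z n))) < a"
      using b(2) s(1) by (auto intro: le_less_trans)
    then show "\<forall>\<^sub>F i in sequentially \<times>\<^sub>F sequentially.
        op_norm (compression e (case i of (m, n) \<Rightarrow> strong_diff (z m) (z n))) < a"
      unfolding eventually_prod_sequentially by auto
  qed simp
  ultimately show ?thesis unfolding bau_cauchy_def bau_null_def nearly_def by blast
qed

text \<open>On a projection with range in the domains of \<open>a\<^sub>n(y)\<close> and \<open>a\<^sub>n(x - y)\<close>, the operator
  \<open>a\<^sub>n(x)\<close> is their pointwise sum. The oscillation of \<open>a\<^sub>n(y)\<close> contributes \<open>\<eta> / 2\<close>, and the two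
  operators \<open>a\<^sub>m(x - y)\<close> and \<open>a\<^sub>n(x - y)\<close> contribute \<open>\<eta> / 4\<close> each.\<close>

lemma oscillation_le_of_approximation:
  fixes a :: "nat \<Rightarrow> 'x::complex_normed_vector \<Rightarrow> 'h operator"
  assumes lin: "\<And>n. linear_into_measurable M \<tau> (a n)"
    and y: "\<And>\<eta>. \<eta> > 0 \<Longrightarrow> nearly (oscillation_le (\<lambda>n. a n y) \<eta>)" and \<eta>: "\<eta> > 0" and \<delta>: "\<delta> > 0"
    and p: "p \<in> projections M" "\<tau> (perp p) \<le> ennreal (\<delta> / 2)"
      "\<And>n. compressed_le (a n (x - y)) (\<eta> / 4) p"
  shows "\<exists>e\<in>projections M. \<tau> (perp e) \<le> ennreal \<delta> \<and> oscillation_le (\<lambda>n. a n x) \<eta> e"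
proof -
  have meas: "a n w \<in> measurable_ops M \<tau>" for n w using lin by (simp add: linear_into_measurable_def)
  let ?D = "\<lambda>e. \<forall>n. in_domain (a n y) e \<and> in_domain (a n (x - y)) e"
  have "nearly (\<lambda>e. oscillation_le (\<lambda>n. a n y) (\<eta> / 2) e \<and> ?D e)"
    using \<eta> by (intro nearly_conj nearly_all hereditary_conj hereditary_all hereditary_oscillation_le
        hereditary_in_domain nearly_in_domain meas y) simp
  then obtain q where q: "q \<in> projections M" "\<tau> (perp q) \<le> ennreal (\<delta> / 2)"
    "oscillation_le (\<lambda>n. a n y) (\<eta> / 2) q" "?D q"
    using \<delta> unfolding nearly_def by (meson half_gt_zero)
  obtain e where e: "e \<in> projections M" and ran: "range e = range p \<inter> range q"
    and "\<tau> (perp e) \<le> \<tau> (perp p) + \<tau> (perp q)"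
    using inf_projection[OF p(1) q(1)] by blast
  note this(3)
  also have "\<dots> \<le> ennreal (\<delta> / 2) + ennreal (\<delta> / 2)" by (rule add_mono[OF p(2) q(2)])
  also have "\<dots> = ennreal \<delta>" using \<delta> by (subst ennreal_plus[symmetric]) auto
  finally have small: "\<tau> (perp e) \<le> ennreal \<delta>" .
  have osc: "oscillation_le (\<lambda>n. a n y) (\<eta> / 2) e"
    using hereditary_oscillation_le q e ran unfolding hereditary_def by blast
  have cmp: "compressed_le (a n (x - y)) (\<eta> / 4) e" for n
    using hereditary_compressed_le p e ran unfolding hereditary_def by blast
  have dom: "range e \<subseteq> Domain (a n y)" "range e \<subseteq> Domain (a n (x - y))" for n
    using q(4) ran unfolding in_domain_def by blast+
  have split: "\<exists>b c. (u, b) \<in> a n y \<and> (u, c) \<in> a n (x - y) \<and> v = b + c"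
    if u: "e u = u" and v: "(u, v) \<in> a n x" for n u v
  proof -
    have "u \<in> range e" using u by (metis rangeI)
    then obtain b c where bc: "(u, b) \<in> a n y" "(u, c) \<in> a n (x - y)" using dom by blast
    have "a n (y + (x - y)) = strong_sum (a n y) (a n (x - y))"
      using lin by (simp only: linear_into_measurable_def)
    then have "(u, b + c) \<in> a n x" using strong_sum_mem[OF bc] by simp
    then show ?thesis using bc measurable_ops_unique[OF meas v] by blast
  qed
  obtain N where N: "\<And>m n u v w. m \<ge> N \<Longrightarrow> n \<ge> N \<Longrightarrow> e u = u \<Longrightarrow> (u, v) \<in> a m y \<Longrightarrow> (u, w) \<in> a n y \<Longrightarrow>
      norm (e (v - w)) \<le> \<eta> / 2 * norm u"
    using osc unfolding oscillation_le_def by blast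
  have "norm (e (v - w)) \<le> \<eta> * norm u"
    if mn: "m \<ge> N" "n \<ge> N" and u: "e u = u" and vw: "(u, v) \<in> a m x" "(u, w) \<in> a n x" for m n u v w
  proof -
    obtain b1 c1 where 1: "(u, b1) \<in> a m y" "(u, c1) \<in> a m (x - y)" "v = b1 + c1"
      using split[OF u vw(1)] by blast
    obtain b2 c2 where 2: "(u, b2) \<in> a n y" "(u, c2) \<in> a n (x - y)" "w = b2 + c2"
      using split[OF u vw(2)] by blast
    have "e (v - w) = e (b1 - b2) + (e c1 - e c2)"
      using projection_bounded[OF e]
      by (simp add: 1(3) 2(3) bounded_clinear_add bounded_clinear_diff)
    also have "norm \<dots> \<le> norm (e (b1 - b2)) + (norm (e c1) + norm (e c2))"
      by (intro order_trans[OF norm_triangle_ineq] add_left_mono norm_triangle_ineq4)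
    also have "\<dots> \<le> \<eta> / 2 * norm u + (\<eta> / 4 * norm u + \<eta> / 4 * norm u)"
      using cmp u 1(2) 2(2) unfolding compressed_le_def by (intro add_mono N[OF mn u 1(1) 2(1)]) auto
    finally show ?thesis by (simp add: field_simps)
  qed
  then have "oscillation_le (\<lambda>n. a n x) \<eta> e" unfolding oscillation_le_def by blast
  then show ?thesis using e small by blast
qed

end


section \<open>The Banach principle for b.a.u. Cauchy sequences\<close>

theorem theorem2p6:
  fixes M :: "('h::complex_hilbert \<Rightarrow> 'h) set"
    and \<tau> :: "('h \<Rightarrow> 'h) \<Rightarrow> ennreal"
    and a :: "nat \<Rightarrow> 'x::complex_banach \<Rightarrow> 'h operator"
    and C \<alpha> :: real
    and X0 :: "'x set"
  assumes "von_neumann_algebra M"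
    and "is_trace M \<tau>" and "faithful_trace M \<tau>" and "normal_trace M \<tau>" and "semifinite_trace M \<tau>"
    and "\<And>n. linear_into_measurable M \<tau> (a n)"
    and "C > 0" and "\<alpha> > 0"
    and "\<And>x \<epsilon>. x \<noteq> 0 \<Longrightarrow> \<epsilon> > 0 \<Longrightarrow>
           \<exists>p\<in>projections M. \<tau> (perp p) < ennreal (C * (inverse \<epsilon> * norm x) powr \<alpha>) \<and>
             (\<forall>n. op_norm (compression p (a n x)) < ennreal \<epsilon>)"
    and "closure X0 = UNIV"
    and "\<And>x. x \<in> X0 \<Longrightarrow> bau_cauchy M \<tau> (\<lambda>n. a n x)"
  shows "\<forall>x. bau_cauchy M \<tau> (\<lambda>n. a n x)"
proof
  fix x
  interpret trace_algebra M \<tau> using assms(1,2,4) by unfold_locales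
  have meas: "a n w \<in> measurable_ops M \<tau>" for n w
    using assms(6) by (simp add: linear_into_measurable_def)
  show "bau_cauchy M \<tau> (\<lambda>n. a n x)"
  proof (cases "x \<in> X0")
    case True
    then show ?thesis by (rule assms(11))
  next
    case False
    have "nearly (oscillation_le (\<lambda>n. a n x) \<eta>)" if \<eta>: "\<eta> > 0" for \<eta>
      unfolding nearly_def
    proof (intro allI impI)
      fix \<delta> :: real assume \<delta>: "\<delta> > 0"
      define t where "t = (\<delta> / (2 * C)) powr (1 / \<alpha>)"
      have t: "t > 0" "C * t powr \<alpha> = \<delta> / 2"
        using \<delta> \<open>C > 0\<close> \<open>\<alpha> > 0\<close> by (simp_all add: t_def powr_powr)
      have "x \<in> closure X0" "t * (\<eta> / 4) > 0" using assms(10) t \<eta> by auto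
      then obtain y where y: "y \<in> X0" "dist y x < t * (\<eta> / 4)" unfolding closure_approachable by blast
      \<comment> \<open>The maximal inequality requires a nonzero vector, which is why \<open>x \<in> X0\<close> is treated separately.\<close>
      have "x - y \<noteq> 0" "\<eta> / 4 > 0" using False y(1) \<eta> by auto
      from assms(9)[OF this] obtain p where p: "p \<in> projections M"
        "\<tau> (perp p) < ennreal (C * (inverse (\<eta> / 4) * norm (x - y)) powr \<alpha>)"
        "\<And>n. op_norm (compression p (a n (x - y))) < ennreal (\<eta> / 4)" by blast
      have "inverse (\<eta> / 4) * norm (x - y) \<le> t"
        using y(2) \<eta> by (simp add: dist_norm norm_minus_commute field_simps)
      then have "(inverse (\<eta> / 4) * norm (x - y)) powr \<alpha> \<le> t powr \<alpha>"
        using \<eta> \<open>\<alpha> > 0\<close> by (intro powr_mono2) auto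
      then have "C * (inverse (\<eta> / 4) * norm (x - y)) powr \<alpha> \<le> \<delta> / 2"
        using \<open>C > 0\<close> by (subst t(2)[symmetric]) (intro mult_left_mono, auto)
      then have small: "\<tau> (perp p) \<le> ennreal (\<delta> / 2)"
        using p(2) by (meson ennreal_leI less_imp_le order_trans)
      show "\<exists>e\<in>projections M. \<tau> (perp e) \<le> ennreal \<delta> \<and> oscillation_le (\<lambda>n. a n x) \<eta> e"
      proof (rule oscillation_le_of_approximation[OF assms(6) _ \<eta> \<delta> p(1) small])
        show "nearly (oscillation_le (\<lambda>n. a n y) \<eta>)" if "\<eta> > 0" for \<eta>
          by (rule bau_cauchy_imp_nearly[OF meas assms(11)[OF y(1)] that])
        show "compressed_le (a n (x - y)) (\<eta> / 4) p" for n
          using p(3)[of n] \<eta>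
          by (intro compressed_le_of_op_norm[OF p(1) measurable_ops_csubspace[OF meas]]) auto
      qed
    qed
    then show ?thesis by (rule nearly_imp_bau_cauchy[OF meas])
  qed
qed
end
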